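(* Under the ideal scaling condition $\dot\gamma=e^{\alpha}$, the generally non-separable Bregman Hamiltonian $$H_{\mathrm{Br}}(X,P,t)=e^{\alpha+\gamma}\Big(D_{h^*}\big(e^{-\gamma}P+\nabla h(X),\nabla h(X)\big)+e^{\beta}f(X)\Big)$$ is equivalent to the separable contact Hamiltonian $$K_{\mathrm{Br}}(\tilde X,\tilde P,\tilde S,t)=e^{\alpha}\Big(h^{*}(\tilde P)-\langle\tilde P,\tilde X\rangle+e^{\beta}f(\tilde X)+\tilde S\Big),$$ for any choice of the convex function $h(X)$.
   Context: Setting. $\mathcal X$ is a convex set (with coordinates $X\in\mathbb R^n$) endowed with a distance-generating function $h:\mathcal X\to\mathbb R$ that is convex and essentially smooth. The objective function $f:\mathcal X\to\mathbb R$ is continuously differentiable, convex, and has a unique minimizer. $\alpha,\beta,\gamma$ are continuously differentiable real functions of time $t$, and a dot denotes the time derivative. The Legendre transform of $h$ is $h^*(P)=\sup_V\big(\langle P,V\rangle-h(V)\big)$. The Bregman divergence induced by a convex function $g$ is $D_g(Y,X)=g(Y)-g(X)-\langle\nabla g(X),Y-X\rangle$. Contact Hamiltonian systems. On the contact phase space with local coordinates $(X,P,S)\in\mathbb R^{2n+1}$ and contact form $\eta=dS-P\,dX$, the contact Hamiltonian system of a (possibly time-dependent) function $\mathcal H(X,P,S,t)$ is $$\dot X=\nabla_P\mathcal H,\qquad \dot P=-\nabla_X\mathcal H-P\,\frac{\partial\mathcal H}{\partial S},\qquad \dot S=\langle\nabla_P\mathcal H,P\rangle-\mathcal H .$$ The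 Bregman Hamiltonian $H_{\mathrm{Br}}$ is regarded as a contact Hamiltonian that does not depend on $S$; the first two equations are then the usual Hamilton equations. Time-dependent contact transformations. A time-dependent contact transformation for the system with contact Hamiltonian $\mathcal H$ is a map $(X,P,S,t)\mapsto(\tilde X,\tilde P,\tilde S,\tilde t=t)$ such that $$d\tilde S-\tilde P\,d\tilde X+K(\tilde X,\tilde P,\tilde S,t)\,dt=\sigma(X,P,S,t)\,\big(dS-P\,dX+\mathcal H(X,P,S,t)\,dt\big)$$ for a nowhere-vanishing function $\sigma$; $K$ is the new contact Hamiltonian in the new coordinates. Equivalent means: related by a time-dependent contact transformation that preserves the dynamics, i.e. that takes the contact Hamiltonian equations of $\mathcal H$ to those of the new contact Hamiltonian $K$. Separable refers to the displayed form of $K_{\mathrm{Br}}$: up to the factor $e^{\alpha}$ it is the sum of a function of $\tilde P$, a function of $\tilde X$ (and $t$), the term $\tilde S$, and the bilinear term $-\langle\tilde P,\tilde X\rangle$, so that it can be discretized explicitly by direct splitting.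
   Formalization: The phase space is restricted to points where h is C² near X and h* is finite and differentiable around ∇h(X) and the new momentum; elsewhere, e.g. where h has an affine piece, D_{h*} or the Hamilton equations are undefined. For C² strictly convex h nothing is lost. *)

theory Defs
  imports "HOL-Analysis.Analysis"
begin

definition grad :: "('a::real_inner \<Rightarrow> real) \<Rightarrow> 'a \<Rightarrow> 'a" where
  "grad g x = (THE D. GDERIV g x :> D)"

text \<open>Continuity of the derivative is required direction by direction, which in finite dimension is
  the same as continuity in operator norm.\<close>

definition C1_on :: "'a::euclidean_space set \<Rightarrow> ('a \<Rightarrow> 'b::real_normed_vector) \<Rightarrow> bool" where
  "C1_on S g \<longleftrightarrow> (\<exists>g'. (\<forall>x\<in>S. (g has_derivative g' x) (at x within S)) \<and>
                      (\<forall>v. continuous_on S (\<lambda>x. g' x v)))"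

definition essentially_smooth_on :: "'a::euclidean_space set \<Rightarrow> ('a \<Rightarrow> real) \<Rightarrow> bool" where
  "essentially_smooth_on C h \<longleftrightarrow>
     interior C \<noteq> {} \<and>
     (\<forall>x\<in>interior C. h differentiable (at x)) \<and>
     (\<forall>u x. (\<forall>k. u k \<in> interior C) \<longrightarrow> u \<longlonglongrightarrow> x \<longrightarrow> x \<in> frontier C \<longrightarrow>
        filterlim (\<lambda>k. norm (grad h (u k))) at_top sequentially)"

definition bregman_data :: "'a::euclidean_space set \<Rightarrow> ('a \<Rightarrow> real) \<Rightarrow> ('a \<Rightarrow> real) \<Rightarrow> bool" where
  "bregman_data C h f \<longleftrightarrow>
     convex C \<and> convex_on C h \<and> essentially_smooth_on C h \<and>
     C1_on C f \<and> convex_on C f \<and> (\<exists>!x. x \<in> C \<and> (\<forall>y\<in>C. f x \<le> f y))"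

text \<open>The supremum may be infinite for some \<open>P\<close>; \<open>legendre C h P\<close> is meaningful only
  where the set is bounded above, and is only used on \<open>dual_region\<close> below.\<close>

definition legendre :: "'a::euclidean_space set \<Rightarrow> ('a \<Rightarrow> real) \<Rightarrow> 'a \<Rightarrow> real" where
  "legendre C h P = (SUP V\<in>C. P \<bullet> V - h V)"

definition bregman_div :: "('a::euclidean_space \<Rightarrow> real) \<Rightarrow> 'a \<Rightarrow> 'a \<Rightarrow> real" where
  "bregman_div g Y X = g Y - g X - grad g X \<bullet> (Y - X)"

text \<open>Points of extended phase space are tuples \<open>(X, P, S, t)\<close>. The covector \<open>P\<close> is identified with
  a vector through the inner product.\<close>

type_synonym 'a phase = "'a \<times> 'a \<times> real \<times> real"

definition time_of :: "'a phase \<Rightarrow> real" where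
  "time_of = (\<lambda>(X, P, S, t). t)"

text \<open>The value of the one-form \<open>dS - P dX + H dt\<close> at a point on a tangent vector.\<close>

definition contact_form :: "('a::euclidean_space phase \<Rightarrow> real) \<Rightarrow> 'a phase \<Rightarrow> 'a phase \<Rightarrow> real" where
  "contact_form H = (\<lambda>(X, P, S, t) (dX, dP, dS, dt). dS - P \<bullet> dX + H (X, P, S, t) * dt)"

text \<open>\<open>H\<close> has the partial derivatives that enter the contact Hamiltonian equations on the open
  region \<open>M\<close>.\<close>

definition contact_hamiltonian :: "'a::euclidean_space phase set \<Rightarrow> ('a phase \<Rightarrow> real) \<Rightarrow> bool" where
  "contact_hamiltonian M H \<longleftrightarrow> open M \<and>
     (\<forall>(X, P, S, t)\<in>M.
        (\<lambda>Y. H (Y, P, S, t)) differentiable (at X) \<and>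
        (\<lambda>Q. H (X, Q, S, t)) differentiable (at P) \<and>
        (\<lambda>s. H (X, P, s, t)) differentiable (at S))"

definition contact_field :: "('a::euclidean_space phase \<Rightarrow> real) \<Rightarrow> 'a phase \<Rightarrow> 'a phase" where
  "contact_field H = (\<lambda>(X, P, S, t).
     let H_X = grad (\<lambda>Y. H (Y, P, S, t)) X;
         H_P = grad (\<lambda>Q. H (X, Q, S, t)) P;
         H_S = deriv (\<lambda>s. H (X, P, s, t)) S
     in (H_P, - H_X - H_S *\<^sub>R P, H_P \<bullet> P - H (X, P, S, t), 1))"

text \<open>A solution is recorded as a curve \<open>t \<mapsto> (X(t), P(t), S(t), t)\<close> in extended phase space.\<close>

definition contact_solution ::
    "'a::euclidean_space phase set \<Rightarrow> ('a phase \<Rightarrow> real) \<Rightarrow> real set \<Rightarrow> (real \<Rightarrow> 'a phase) \<Rightarrow> bool" where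
  "contact_solution M H I z \<longleftrightarrow>
     (\<forall>t\<in>I. z t \<in> M \<and> time_of (z t) = t \<and>
        (z has_vector_derivative contact_field H (z t)) (at t within I))"

definition contact_transformation ::
    "'a::euclidean_space phase set \<Rightarrow> ('a phase \<Rightarrow> real) \<Rightarrow> 'a phase set \<Rightarrow> ('a phase \<Rightarrow> real) \<Rightarrow>
     ('a phase \<Rightarrow> 'a phase) \<Rightarrow> ('a phase \<Rightarrow> real) \<Rightarrow> bool" where
  "contact_transformation M H M' K \<Phi> \<sigma> \<longleftrightarrow>
     bij_betw \<Phi> M M' \<and> C1_on M \<Phi> \<and> C1_on M' (inv_into M \<Phi>) \<and>
     (\<forall>z\<in>M. time_of (\<Phi> z) = time_of z) \<and>
     (\<forall>z\<in>M. \<sigma> z \<noteq> 0) \<and>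
     (\<forall>z\<in>M. \<forall>v. contact_form K (\<Phi> z) (frechet_derivative \<Phi> (at z) v) = \<sigma> z * contact_form H z v)"

text \<open>Since \<open>\<Phi>\<close> is a bijection between the two regions, the following accounts for all solutions
  on either side.\<close>

definition preserves_dynamics ::
    "'a::euclidean_space phase set \<Rightarrow> ('a phase \<Rightarrow> real) \<Rightarrow> 'a phase set \<Rightarrow> ('a phase \<Rightarrow> real) \<Rightarrow>
     ('a phase \<Rightarrow> 'a phase) \<Rightarrow> bool" where
  "preserves_dynamics M H M' K \<Phi> \<longleftrightarrow>
     (\<forall>I z. is_interval I \<longrightarrow> z ` I \<subseteq> M \<longrightarrow>
        (contact_solution M H I z \<longleftrightarrow> contact_solution M' K I (\<Phi> \<circ> z)))"

definition contact_equivalent ::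
    "'a::euclidean_space phase set \<Rightarrow> ('a phase \<Rightarrow> real) \<Rightarrow> 'a phase set \<Rightarrow> ('a phase \<Rightarrow> real) \<Rightarrow> bool" where
  "contact_equivalent M H M' K \<longleftrightarrow>
     contact_hamiltonian M H \<and> contact_hamiltonian M' K \<and>
     (\<exists>\<Phi> \<sigma>. contact_transformation M H M' K \<Phi> \<sigma> \<and> preserves_dynamics M H M' K \<Phi>)"

text \<open>The term in \<open>S\<close> and the bilinear term are allowed but need not occur. A common time-dependent
  factor is absorbed into \<open>A\<close>, \<open>B\<close>, \<open>c\<close>, \<open>d\<close>.\<close>

definition separable_on :: "'a::euclidean_space phase set \<Rightarrow> ('a phase \<Rightarrow> real) \<Rightarrow> bool" where
  "separable_on M H \<longleftrightarrow>
     (\<exists>(A :: 'a \<Rightarrow> real \<Rightarrow> real) (B :: 'a \<Rightarrow> real \<Rightarrow> real) (c :: real \<Rightarrow> real) (d :: real \<Rightarrow> real).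
        \<forall>(X, P, S, t)\<in>M. H (X, P, S, t) = A P t + B X t + c t * S + d t * (P \<bullet> X))"

definition H_Br ::
    "(real \<Rightarrow> real) \<Rightarrow> (real \<Rightarrow> real) \<Rightarrow> (real \<Rightarrow> real) \<Rightarrow> 'a::euclidean_space set \<Rightarrow>
     ('a \<Rightarrow> real) \<Rightarrow> ('a \<Rightarrow> real) \<Rightarrow> 'a phase \<Rightarrow> real" where
  "H_Br \<alpha> \<beta> \<gamma> C h f = (\<lambda>(X, P, S, t).
     exp (\<alpha> t + \<gamma> t) *
       (bregman_div (legendre C h) (exp (- \<gamma> t) *\<^sub>R P + grad h X) (grad h X) + exp (\<beta> t) * f X))"

definition K_Br ::
    "(real \<Rightarrow> real) \<Rightarrow> (real \<Rightarrow> real) \<Rightarrow> 'a::euclidean_space set \<Rightarrow>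
     ('a \<Rightarrow> real) \<Rightarrow> ('a \<Rightarrow> real) \<Rightarrow> 'a phase \<Rightarrow> real" where
  "K_Br \<alpha> \<beta> C h f = (\<lambda>(X, P, S, t).
     exp (\<alpha> t) * (legendre C h P - P \<bullet> X + exp (\<beta> t) * f X + S))"

text \<open>The formula for \<open>H_Br\<close> and its equations of motion involve the gradient of \<open>legendre C h\<close> at
  \<open>grad h X\<close> and at the shifted momentum, and the derivative of \<open>grad h\<close>. A convex, essentially smooth
  \<open>h\<close> need not provide these everywhere (an affine piece of \<open>h\<close> produces a kink of the transform), so
  no further hypothesis is placed on \<open>h\<close>; instead the phase space consists of the points around which
  the expressions are defined. If \<open>h\<close> is strictly convex and \<open>C\<^sup>2\<close> on \<open>interior C\<close> these regions are
  all of \<open>interior C\<close> and the interior of the effective domain of the transform.\<close>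

definition dual_region :: "'a::euclidean_space set \<Rightarrow> ('a \<Rightarrow> real) \<Rightarrow> 'a set" where
  "dual_region C h =
     interior {P. bdd_above ((\<lambda>V. P \<bullet> V - h V) ` C) \<and> legendre C h differentiable (at P)}"

definition primal_region :: "'a::euclidean_space set \<Rightarrow> ('a \<Rightarrow> real) \<Rightarrow> 'a set" where
  "primal_region C h =
     \<Union>{U. open U \<and> U \<subseteq> C \<and> C1_on U (grad h) \<and> grad h ` U \<subseteq> dual_region C h}"

definition H_domain ::
    "real set \<Rightarrow> (real \<Rightarrow> real) \<Rightarrow> 'a::euclidean_space set \<Rightarrow> ('a \<Rightarrow> real) \<Rightarrow> 'a phase set" where
  "H_domain T \<gamma> C h =
     {(X, P, S, t). t \<in> T \<and> X \<in> primal_region C h \<and> exp (- \<gamma> t) *\<^sub>R P + grad h X \<in> dual_region C h}"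

definition K_domain ::
    "real set \<Rightarrow> 'a::euclidean_space set \<Rightarrow> ('a \<Rightarrow> real) \<Rightarrow> 'a phase set" where
  "K_domain T C h = {(X, P, S, t). t \<in> T \<and> X \<in> primal_region C h \<and> P \<in> dual_region C h}"

end

theory Submission
  imports Defs
begin

text \<open>For \<open>X\<close> in the primal region \<open>X\<close> is a subgradient of \<open>h\<^sup>*\<close> at \<open>\<nabla>h(X)\<close>, so
  \<open>\<nabla>h\<^sup>*(\<nabla>h(X)) = X\<close>, and with \<open>Q = e\<^bsup>-\<gamma>\<^esup>P + \<nabla>h(X)\<close> the Bregman Hamiltonian becomes
  \<open>e\<^bsup>\<alpha>+\<gamma>\<^esup>(h\<^sup>*(Q) - \<langle>Q,X\<rangle> + h(X) + e\<^sup>\<beta>f(X))\<close>. The contact transformation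
  \<open>(X,P,S) \<mapsto> (X, Q, e\<^bsup>-\<gamma>\<^esup>S + h(X))\<close> multiplies the contact form by \<open>e\<^bsup>-\<gamma>\<^esup>\<close>; under the ideal scaling,
  differentiating \<open>e\<^bsup>-\<gamma>\<^esup>S\<close> in time contributes the term \<open>e\<^sup>\<alpha>(S' - h(X))\<close>, whose \<open>h(X)\<close> cancels the one
  above. That the contact equations correspond uses the symmetry of the Hessian of \<open>h\<close>. The witness of
  non-separability is \<open>h(x) = \<surd>(1 + |x|\<^sup>2)\<close> with \<open>h\<^sup>*(P) = -\<surd>(1 - |P|\<^sup>2)\<close> on the open unit ball.\<close>

subsection \<open>Gradients and the symmetry of the Hessian\<close>

lemma grad_eqI: "GDERIV g x :> D \<Longrightarrow> grad g x = D"
  unfolding grad_def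
proof (rule the_equality)
  fix E assume "GDERIV g x :> D" "GDERIV g x :> E"
  then have "(\<lambda>v. v \<bullet> D) = (\<lambda>v. v \<bullet> E)"
    unfolding gderiv_def by (rule has_derivative_unique)
  then show "E = D"
    by (metis inner_commute vector_eq_ldot)
qed

text \<open>In finite dimension a linear functional is the inner product with the vector of its
  values on the basis, so differentiability already yields a gradient.\<close>

lemma GDERIV_grad:
  fixes g :: "'a::euclidean_space \<Rightarrow> real"
  assumes "g differentiable at x"
  shows "GDERIV g x :> grad g x"
proof -
  obtain g' where g': "(g has_derivative g') (at x)"
    using assms by (auto simp: differentiable_def)
  interpret linear g' using g' by (rule has_derivative_linear)
  let ?D = "\<Sum>b\<in>Basis. g' b *\<^sub>R b"
  have "g' v = v \<bullet> ?D" for v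
  proof -
    have "g' v = g' (\<Sum>b\<in>Basis. (v \<bullet> b) *\<^sub>R b)" by (simp add: euclidean_representation)
    also have "\<dots> = v \<bullet> ?D" by (simp add: sum scale inner_sum_right mult.commute)
    finally show ?thesis .
  qed
  then have "g' = (\<lambda>v. v \<bullet> ?D)" by (rule ext)
  with g' have "GDERIV g x :> ?D" by (simp add: gderiv_def)
  with grad_eqI show ?thesis by metis
qed

text \<open>The mixed second difference is a plain increment of \<open>h (x + r *\<^sub>R u + s
  *\<^sub>R v) - h (x + r *\<^sub>R u)\<close> from \<open>r = 0\<close> to \<open>r = s\<close>.
  The mean value theorem turns it into a difference of two values of \<open>g\<close>, and both are
  linearised at \<open>x\<close>.\<close>

lemma second_difference_bound:
  fixes h :: "'a::real_inner \<Rightarrow> real"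
  assumes U: "open U" "x \<in> U" and h: "\<And>y. y \<in> U \<Longrightarrow> GDERIV h y :> g y"
    and A: "(g has_derivative A) (at x)" and e: "e > 0"
  shows "\<exists>d>0. \<forall>s. 0 < s \<and> s < d \<longrightarrow>
    \<bar>h (x + s *\<^sub>R u + s *\<^sub>R v) - h (x + s *\<^sub>R u) - h (x + s *\<^sub>R v) + h x - s\<^sup>2 * (A v \<bullet> u)\<bar>
      \<le> s\<^sup>2 * (e * (2 * (norm u + norm v) * norm u))"
proof -
  interpret A: bounded_linear A using A by (rule has_derivative_bounded_linear)
  obtain d1 where d1: "d1 > 0" "\<And>y. norm (y - x) < d1 \<Longrightarrow> norm (g y - g x - A (y - x)) \<le> e * norm (y - x)"
    using conjunct2[OF A[unfolded has_derivative_at_alt], rule_format, OF e] by auto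
  obtain d2 where d2: "d2 > 0" "ball x d2 \<subseteq> U" using U by (meson openE)
  let ?N = "norm u + norm v"
  \<comment> \<open>The summand 1 keeps the denominator positive when \<open>u\<close> and
    \<open>v\<close> both vanish. Below this bound the whole parallelogram stays in \<open>U\<close>
    and in the range of the linearisation.\<close>
  let ?d = "min d1 d2 / (?N + 1)"
  have N: "?N \<ge> 0" by simp
  have "?d > 0" using d1 d2 N by (smt (verit) divide_pos_pos)
  moreover have "\<bar>h (x + s *\<^sub>R u + s *\<^sub>R v) - h (x + s *\<^sub>R u) - h (x + s *\<^sub>R v) + h x - s\<^sup>2 * (A v \<bullet> u)\<bar>
      \<le> s\<^sup>2 * (e * (2 * ?N * norm u))" if s: "0 < s" "s < ?d" for s
  proof -
    have sN: "s * ?N < min d1 d2"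
    proof -
      have "s * ?N \<le> s * (?N + 1)" using s by (simp add: mult_left_mono)
      also have "\<dots> < min d1 d2" using s N by (simp add: pos_less_divide_eq)
      finally show ?thesis .
    qed
    have small: "norm (r *\<^sub>R u + w *\<^sub>R v) \<le> s * ?N" if "0 \<le> r" "r \<le> s" "0 \<le> w" "w \<le> s" for r w
    proof -
      have "norm (r *\<^sub>R u + w *\<^sub>R v) \<le> r * norm u + w * norm v"
        using that norm_triangle_ineq[of "r *\<^sub>R u" "w *\<^sub>R v"] by simp
      also have "\<dots> \<le> s * norm u + s * norm v"
        using that by (intro add_mono mult_right_mono) auto
      finally show ?thesis by (simp add: algebra_simps)
    qed
    have inU: "x + r *\<^sub>R u + w *\<^sub>R v \<in> U" if "0 \<le> r" "r \<le> s" "0 \<le> w" "w \<le> s" for r w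
    proof -
      have "x + r *\<^sub>R u + w *\<^sub>R v \<in> ball x d2"
        using small[OF that] sN by (simp add: dist_norm norm_minus_commute add.assoc algebra_simps)
      with d2 show ?thesis by blast
    qed
    \<comment> \<open>The redundant \<open>0 *\<^sub>R v\<close> lets \<open>inU\<close> and the
      remainder \<open>E\<close> treat both edges alike, as the cases \<open>w = s\<close> and
      \<open>w = 0\<close>.\<close>
    let ?\<phi> = "\<lambda>r. h (x + r *\<^sub>R u + s *\<^sub>R v) - h (x + r *\<^sub>R u + 0 *\<^sub>R v)"
    have der: "(?\<phi> has_derivative (\<lambda>k. k * ((g (x + r *\<^sub>R u + s *\<^sub>R v) - g (x + r *\<^sub>R u + 0 *\<^sub>R v)) \<bullet> u))) (at r)"
      if "0 \<le> r" "r \<le> s" for r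
    proof -
      have 1: "((\<lambda>r. h (x + r *\<^sub>R u + w *\<^sub>R v)) has_derivative (\<lambda>k. (k *\<^sub>R u) \<bullet> g (x + r *\<^sub>R u + w *\<^sub>R v))) (at r)"
        if w: "0 \<le> w" "w \<le> s" for w
      proof (rule has_derivative_compose[where f = "\<lambda>r. x + r *\<^sub>R u + w *\<^sub>R v" and g = h])
        show "((\<lambda>r. x + r *\<^sub>R u + w *\<^sub>R v) has_derivative (\<lambda>k. k *\<^sub>R u)) (at r)"
          by (auto intro!: derivative_eq_intros)
        show "(h has_derivative (\<lambda>k. k \<bullet> g (x + r *\<^sub>R u + w *\<^sub>R v))) (at (x + r *\<^sub>R u + w *\<^sub>R v))"
          using h[OF inU[OF \<open>0 \<le> r\<close> \<open>r \<le> s\<close> w]] by (simp add: gderiv_def)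
      qed
      show ?thesis
        using has_derivative_diff[OF 1[of s] 1[of 0]] s
        by (simp add: inner_diff_left inner_diff_right inner_commute algebra_simps)
    qed
    have "continuous_on {0..s} ?\<phi>"
      using der by (intro has_derivative_continuous_on) (auto intro: has_derivative_at_withinI)
    then obtain \<xi> where \<xi>: "0 < \<xi>" "\<xi> < s"
      and mv: "?\<phi> s - ?\<phi> 0 = (s - 0) * ((g (x + \<xi> *\<^sub>R u + s *\<^sub>R v) - g (x + \<xi> *\<^sub>R u + 0 *\<^sub>R v)) \<bullet> u)"
      by (rule mvt[OF s(1) _ der]) auto
    define E where "E w = g (x + \<xi> *\<^sub>R u + w *\<^sub>R v) - g x - A (\<xi> *\<^sub>R u + w *\<^sub>R v)" for w
    have E: "norm (E w) \<le> e * (s * ?N)" if "0 \<le> w" "w \<le> s" for w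
    proof -
      have sm: "norm (\<xi> *\<^sub>R u + w *\<^sub>R v) \<le> s * ?N" using small[of \<xi> w] \<xi> that by simp
      have eq: "x + \<xi> *\<^sub>R u + w *\<^sub>R v - x = \<xi> *\<^sub>R u + w *\<^sub>R v" by simp
      have "norm (E w) \<le> e * norm (\<xi> *\<^sub>R u + w *\<^sub>R v)"
        using d1(2)[of "x + \<xi> *\<^sub>R u + w *\<^sub>R v"] sm sN unfolding eq E_def by simp
      also have "\<dots> \<le> e * (s * ?N)" using sm e by simp
      finally show ?thesis .
    qed
    \<comment> \<open>By linearity of \<open>A\<close> the contributions of
      \<open>\<xi> *\<^sub>R u\<close> cancel between the two edges; only
      \<open>s *\<^sub>R A v\<close> and the two remainders survive.\<close>
    have "?\<phi> s - ?\<phi> 0 - s\<^sup>2 * (A v \<bullet> u) = s * ((E s - E 0) \<bullet> u)"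
      unfolding mv E_def
      by (simp add: A.add A.scaleR inner_diff_left inner_add_left algebra_simps power2_eq_square)
    also have "\<bar>\<dots>\<bar> \<le> s * (norm (E s - E 0) * norm u)"
      using s Cauchy_Schwarz_ineq2[of "E s - E 0" u] by (simp add: abs_mult)
    also have "\<dots> \<le> s * ((e * (s * ?N) + e * (s * ?N)) * norm u)"
      using s E[of s] E[of 0] norm_triangle_ineq4[of "E s" "E 0"]
      by (intro mult_left_mono mult_right_mono) auto
    also have "\<dots> = s\<^sup>2 * (e * (2 * ?N * norm u))"
      by (simp add: power2_eq_square algebra_simps)
    finally show ?thesis by (simp add: algebra_simps)
  qed
  ultimately show ?thesis by blast
qed

text \<open>The second difference does not change when \<open>u\<close> and \<open>v\<close> are
  swapped, while after division by the square of \<open>s\<close> it is arbitrarily close to both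
  inner products.\<close>

lemma derivative_of_gradient_symmetric:
  fixes h :: "'a::real_inner \<Rightarrow> real"
  assumes U: "open U" "x \<in> U" and h: "\<And>y. y \<in> U \<Longrightarrow> GDERIV h y :> g y"
    and A: "(g has_derivative A) (at x)"
  shows "A u \<bullet> v = u \<bullet> A v"
proof -
  define K where "K = 2 * (norm u + norm v) * norm u + 2 * (norm v + norm u) * norm v"
  have "\<bar>A v \<bullet> u - A u \<bullet> v\<bar> \<le> e * K" if e: "e > 0" for e
  proof -
    let ?q = "\<lambda>u v s. h (x + s *\<^sub>R u + s *\<^sub>R v) - h (x + s *\<^sub>R u) - h (x + s *\<^sub>R v) + h x"
    obtain d1 where d1: "d1 > 0" "\<And>s. 0 < s \<and> s < d1 \<Longrightarrow>
      \<bar>?q u v s - s\<^sup>2 * (A v \<bullet> u)\<bar> \<le> s\<^sup>2 * (e * (2 * (norm u + norm v) * norm u))"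
      using second_difference_bound[OF U h A e, of u v] by blast
    obtain d2 where d2: "d2 > 0" "\<And>s. 0 < s \<and> s < d2 \<Longrightarrow>
      \<bar>?q v u s - s\<^sup>2 * (A u \<bullet> v)\<bar> \<le> s\<^sup>2 * (e * (2 * (norm v + norm u) * norm v))"
      using second_difference_bound[OF U h A e, of v u] by blast
    define s where "s = min d1 d2 / 2"
    have s: "0 < s" "s < d1" "s < d2" using d1 d2 by (auto simp: s_def)
    have "?q u v s = ?q v u s" by (simp add: algebra_simps)
    then have "\<bar>s\<^sup>2 * (A v \<bullet> u) - s\<^sup>2 * (A u \<bullet> v)\<bar>
        \<le> s\<^sup>2 * (e * (2 * (norm u + norm v) * norm u)) + s\<^sup>2 * (e * (2 * (norm v + norm u) * norm v))"
      using d1(2)[of s] d2(2)[of s] s by linarith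
    then have "s\<^sup>2 * \<bar>A v \<bullet> u - A u \<bullet> v\<bar> \<le> s\<^sup>2 * (e * K)"
      unfolding right_diff_distrib[symmetric] abs_mult K_def by (simp add: algebra_simps)
    with s show ?thesis by simp
  qed
  moreover have "K \<ge> 0" by (simp add: K_def)
  ultimately have "\<bar>A v \<bullet> u - A u \<bullet> v\<bar> \<le> 0 + e" if "e > 0" for e
  proof -
    \<comment> \<open>\<open>K\<close> vanishes when \<open>u\<close> and \<open>v\<close> do, hence
      the division by \<open>K + 1\<close>.\<close>
    have "e / (K + 1) > 0" using that \<open>K \<ge> 0\<close> by simp
    then have "\<bar>A v \<bullet> u - A u \<bullet> v\<bar> \<le> e / (K + 1) * K" by fact
    also have "\<dots> \<le> e" using that \<open>K \<ge> 0\<close> by (simp add: divide_simps)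
    finally show ?thesis by simp
  qed
  then have "\<bar>A v \<bullet> u - A u \<bullet> v\<bar> \<le> 0" by (rule field_le_epsilon)
  then show ?thesis by (simp add: inner_commute)
qed

text \<open>Convexity bounds the difference quotients along the segment by \<open>h y - h x\<close>,
  and their limit is the directional derivative. The limit is taken from the right because only
  parameters between 0 and 1 are known to stay in \<open>C\<close>.\<close>

lemma convex_on_above_gradient:
  fixes h :: "'a::real_inner \<Rightarrow> real"
  assumes h: "convex_on C h" and x: "x \<in> C" and y: "y \<in> C" and D: "GDERIV h x :> D"
  shows "h x + D \<bullet> (y - x) \<le> h y"
proof -
  let ?\<phi> = "\<lambda>s::real. h (x + s *\<^sub>R (y - x))"
  have "(?\<phi> has_derivative (\<lambda>k. (k *\<^sub>R (y - x)) \<bullet> D)) (at 0)"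
    by (rule has_derivative_compose[where g = h and f = "\<lambda>s. x + s *\<^sub>R (y - x)"])
       (use D in \<open>auto intro!: derivative_eq_intros simp: gderiv_def\<close>)
  then have "(?\<phi> has_real_derivative D \<bullet> (y - x)) (at 0)"
    by (simp add: has_field_derivative_def inner_commute mult.commute[of _ "D \<bullet> _"])
  then have "((\<lambda>s. (?\<phi> s - ?\<phi> 0) / s) \<longlongrightarrow> D \<bullet> (y - x)) (at 0)"
    by (simp add: has_field_derivative_iff)
  then have lim: "((\<lambda>s. (?\<phi> s - ?\<phi> 0) / s) \<longlongrightarrow> D \<bullet> (y - x)) (at_right 0)"
    by (rule filterlim_mono) (auto simp: at_le)
  have "\<forall>\<^sub>F s in at_right 0. (?\<phi> s - ?\<phi> 0) / s \<le> h y - h x"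
  proof -
    have "\<forall>\<^sub>F s::real in at_right 0. s \<in> {0<..<1}"
      by (rule eventually_at_right_real) simp
    then show ?thesis
    proof eventually_elim
      case (elim s)
      have "?\<phi> s = h ((1 - s) *\<^sub>R x + s *\<^sub>R y)" by (simp add: algebra_simps)
      also have "\<dots> \<le> (1 - s) * h x + s * h y"
        using h x y elim by (intro convex_onD) auto
      finally have "?\<phi> s - ?\<phi> 0 \<le> (h y - h x) * s" by (simp add: algebra_simps)
      then show ?case using elim by (simp add: pos_divide_le_eq)
    qed
  qed
  with lim have "D \<bullet> (y - x) \<le> h y - h x"
    by (intro tendsto_upperbound) auto
  then show ?thesis by simp
qed

subsection \<open>The Legendre transform on the primal region\<close>

definition hess :: "('a::euclidean_space \<Rightarrow> real) \<Rightarrow> 'a \<Rightarrow> 'a \<Rightarrow> 'a" where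
  "hess h X = frechet_derivative (grad h) (at X)"

lemma open_dual_region: "open (dual_region C h)"
  by (simp add: dual_region_def)

lemma open_primal_region: "open (primal_region C h)"
  by (auto simp: primal_region_def)

lemma primal_region_subset_interior: "primal_region C h \<subseteq> interior C"
  by (auto simp: primal_region_def interior_def)

lemma grad_in_dual_region: "X \<in> primal_region C h \<Longrightarrow> grad h X \<in> dual_region C h"
  by (auto simp: primal_region_def)

lemma dual_region_bdd_above: "Q \<in> dual_region C h \<Longrightarrow> bdd_above ((\<lambda>V. Q \<bullet> V - h V) ` C)"
  unfolding dual_region_def by (drule subsetD[OF interior_subset]) simp

lemma GDERIV_legendre:
  assumes "Q \<in> dual_region C h"
  shows "GDERIV (legendre C h) Q :> grad (legendre C h) Q"
proof (rule GDERIV_grad)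
  show "legendre C h differentiable at Q"
    using subsetD[OF interior_subset assms[unfolded dual_region_def]] by simp
qed

lemma legendre_upper:
  assumes "Q \<in> dual_region C h" "V \<in> C"
  shows "Q \<bullet> V - h V \<le> legendre C h Q"
  unfolding legendre_def by (rule cSUP_upper[OF assms(2) dual_region_bdd_above[OF assms(1)]])

text \<open>On an open set uniqueness makes any derivative witnessing \<open>C1_on\<close> the
  Frechet derivative. Witnesses on the different open sets that make up the primal region therefore
  agree, and continuity of the Hessian glues over their union.\<close>

lemma C1_on_open_frechet:
  assumes U: "open U" and g: "C1_on U g"
  shows "\<And>x. x \<in> U \<Longrightarrow> (g has_derivative frechet_derivative g (at x)) (at x)"
    and "continuous_on U (\<lambda>x. frechet_derivative g (at x) v)"
proof -
  obtain g' where g': "\<And>x. x \<in> U \<Longrightarrow> (g has_derivative g' x) (at x within U)"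
    and cont: "\<And>v. continuous_on U (\<lambda>x. g' x v)"
    using g by (auto simp: C1_on_def)
  have eq: "g' x = frechet_derivative g (at x)" if "x \<in> U" for x
    by (rule frechet_derivative_at) (use g'[OF that] in \<open>simp only: at_within_open[OF that U]\<close>)
  show "(g has_derivative frechet_derivative g (at x)) (at x)" if "x \<in> U" for x
    using g'[OF that] by (simp only: at_within_open[OF that U] eq[OF that])
  show "continuous_on U (\<lambda>x. frechet_derivative g (at x) v)"
    using cont[of v] by (rule continuous_on_eq) (simp add: eq)
qed

lemma has_derivative_grad:
  assumes "X \<in> primal_region C h"
  shows "(grad h has_derivative hess h X) (at X)"
  using assms C1_on_open_frechet(1) unfolding primal_region_def hess_def by blast

lemma continuous_on_hess: "continuous_on (primal_region C h) (\<lambda>X. hess h X v)"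
  unfolding primal_region_def hess_def
  by (rule continuous_on_open_Union) (auto intro: C1_on_open_frechet(2))

lemma continuous_on_grad: "continuous_on (primal_region C h) (grad h)"
  by (auto intro!: continuous_at_imp_continuous_on has_derivative_continuous has_derivative_grad)

locale bregman =
  fixes C :: "'a::euclidean_space set" and h f :: "'a \<Rightarrow> real"
  assumes data: "bregman_data C h f"
begin

abbreviation "primal \<equiv> primal_region C h"
abbreviation "dual \<equiv> dual_region C h"
abbreviation "L \<equiv> legendre C h"

lemma GDERIV_h:
  assumes "X \<in> primal"
  shows "GDERIV h X :> grad h X"
proof (rule GDERIV_grad)
  show "h differentiable at X"
    using assms data primal_region_subset_interior
    unfolding bregman_data_def essentially_smooth_on_def by blast
qed

lemma continuous_on_h: "continuous_on primal h"
  using GDERIV_h unfolding gderiv_def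
  by (blast intro: continuous_at_imp_continuous_on has_derivative_continuous)

lemma GDERIV_f:
  assumes "X \<in> primal"
  shows "GDERIV f X :> grad f X"
proof (rule GDERIV_grad)
  have X: "X \<in> interior C" using assms primal_region_subset_interior by blast
  then have "\<exists>f'. (f has_derivative f') (at X within C)"
    using data interior_subset unfolding bregman_data_def C1_on_def by blast
  then show "f differentiable at X"
    unfolding differentiable_def at_within_interior[OF X] .
qed

lemma hess_symmetric: "X \<in> primal \<Longrightarrow> hess h X u \<bullet> v = u \<bullet> hess h X v"
  using derivative_of_gradient_symmetric[OF open_primal_region _ GDERIV_h has_derivative_grad] by blast

text \<open>Equality case of the Fenchel-Young inequality: by the gradient inequality the supremum
  is attained at \<open>V = X\<close>.\<close>

lemma legendre_grad:
  assumes X: "X \<in> primal"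
  shows "L (grad h X) = grad h X \<bullet> X - h X"
proof (rule antisym)
  have XC: "X \<in> C" using X primal_region_subset_interior interior_subset by blast
  have h: "convex_on C h" using data by (simp add: bregman_data_def)
  show "L (grad h X) \<le> grad h X \<bullet> X - h X"
    unfolding legendre_def
  proof (rule cSUP_least)
    show "C \<noteq> {}" using XC by auto
    show "grad h X \<bullet> V - h V \<le> grad h X \<bullet> X - h X" if "V \<in> C" for V
      using convex_on_above_gradient[OF h XC that GDERIV_h[OF X]] by (simp add: inner_diff_right)
  qed
  show "grad h X \<bullet> X - h X \<le> L (grad h X)"
    using grad_in_dual_region[OF X] XC by (rule legendre_upper)
qed

text \<open>\<open>L Q - Q \<bullet> X\<close> attains its minimum \<open>- h X\<close> at \<open>Q = grad h X\<close>, so its gradient vanishes there.\<close>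

lemma grad_legendre_grad:
  assumes X: "X \<in> primal"
  shows "grad L (grad h X) = X"
proof -
  have XC: "X \<in> C" using X primal_region_subset_interior interior_subset by blast
  let ?Q = "grad h X"
  have Q: "?Q \<in> dual" using X by (rule grad_in_dual_region)
  have "((\<lambda>Q. L Q - Q \<bullet> X) has_derivative (\<lambda>v. v \<bullet> grad L ?Q - v \<bullet> X)) (at ?Q)"
    using GDERIV_legendre[OF Q] by (auto intro!: derivative_eq_intros simp: gderiv_def)
  moreover have "\<forall>Q\<in>dual. L ?Q - ?Q \<bullet> X \<le> L Q - Q \<bullet> X"
    using legendre_upper[OF _ XC] legendre_grad[OF X] by (force simp: algebra_simps)
  ultimately have "(\<lambda>v. v \<bullet> grad L ?Q - v \<bullet> X) = (\<lambda>v. 0)"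
    using differential_zero_maxmin[OF Q open_dual_region] by blast
  \<comment> \<open>The vanishing functional is evaluated at the vector that represents it.\<close>
  then have "(grad L ?Q - X) \<bullet> (grad L ?Q - X) = 0"
    by (metis inner_diff_right)
  then show ?thesis by simp
qed

end

subsection \<open>The contact transformation\<close>

text \<open>Solutions are carried forward by the chain rule. For the converse, differentiating
  \<open>\<Psi> (\<Phi> w) = w\<close> shows that the derivative of \<open>\<Psi>\<close> carries
  the field of \<open>K\<close> back to that of \<open>H\<close>, and the same argument applies to
  the inverse.\<close>

lemma preserves_dynamicsI:
  fixes H K :: "'a::euclidean_space phase \<Rightarrow> real"
  assumes M: "open M"
    and \<Phi>: "\<And>z. z \<in> M \<Longrightarrow> (\<Phi> has_derivative \<Phi>' z) (at z)"
    and \<Psi>: "\<And>w. w \<in> M' \<Longrightarrow> (\<Psi> has_derivative \<Psi>' w) (at w)"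
    and into: "\<And>z. z \<in> M \<Longrightarrow> \<Phi> z \<in> M'"
    and inverse: "\<And>z. z \<in> M \<Longrightarrow> \<Psi> (\<Phi> z) = z"
    and time: "\<And>z. z \<in> M \<Longrightarrow> time_of (\<Phi> z) = time_of z"
    and field: "\<And>z. z \<in> M \<Longrightarrow> \<Phi>' z (contact_field H z) = contact_field K (\<Phi> z)"
  shows "preserves_dynamics M H M' K \<Phi>"
  unfolding preserves_dynamics_def
proof (intro allI impI)
  fix I and z :: "real \<Rightarrow> 'a phase"
  assume zM: "z ` I \<subseteq> M"
  have field': "\<Psi>' (\<Phi> w) (contact_field K (\<Phi> w)) = contact_field H w" if w: "w \<in> M" for w
  proof -
    have "((\<lambda>w. \<Psi> (\<Phi> w)) has_derivative (\<lambda>v. \<Psi>' (\<Phi> w) (\<Phi>' w v))) (at w)"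
      using \<Phi>[OF w] \<Psi>[OF into[OF w]] by (rule has_derivative_compose)
    then have "((\<lambda>w. w) has_derivative (\<lambda>v. \<Psi>' (\<Phi> w) (\<Phi>' w v))) (at w)"
      by (rule has_derivative_transform_within_open[OF _ M w]) (rule inverse)
    then have "(\<lambda>v. \<Psi>' (\<Phi> w) (\<Phi>' w v)) = (\<lambda>v. v)"
      by (rule has_derivative_unique) (rule has_derivative_ident)
    then show ?thesis
      by (metis field[OF w])
  qed
  show "contact_solution M H I z \<longleftrightarrow> contact_solution M' K I (\<Phi> \<circ> z)"
  proof
    assume L: "contact_solution M H I z"
    show "contact_solution M' K I (\<Phi> \<circ> z)"
      unfolding contact_solution_def
    proof (intro ballI conjI)
      fix t assume t: "t \<in> I"
      then have zt: "z t \<in> M" "time_of (z t) = t"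
        and dz: "(z has_vector_derivative contact_field H (z t)) (at t within I)"
        using L by (auto simp: contact_solution_def)
      show "(\<Phi> \<circ> z) t \<in> M'" "time_of ((\<Phi> \<circ> z) t) = t"
        using zt into time by auto
      show "(\<Phi> \<circ> z has_vector_derivative contact_field K ((\<Phi> \<circ> z) t)) (at t within I)"
        using vector_derivative_diff_chain_within[OF dz has_derivative_at_withinI[OF \<Phi>[OF zt(1)]]]
        by (simp add: field[OF zt(1)])
    qed
  next
    assume R: "contact_solution M' K I (\<Phi> \<circ> z)"
    show "contact_solution M H I z"
      unfolding contact_solution_def
    proof (intro ballI conjI)
      fix t assume t: "t \<in> I"
      show zt: "z t \<in> M" using t zM by auto
      show "time_of (z t) = t" using R t time[OF zt] by (auto simp: contact_solution_def)
      have dz: "(\<Phi> \<circ> z has_vector_derivative contact_field K (\<Phi> (z t))) (at t within I)"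
        using R t by (auto simp: contact_solution_def)
      have "(\<Psi> has_derivative \<Psi>' (\<Phi> (z t))) (at ((\<Phi> \<circ> z) t) within (\<Phi> \<circ> z) ` I)"
        using has_derivative_at_withinI[OF \<Psi>[OF into[OF zt]]] by simp
      from vector_derivative_diff_chain_within[OF dz this]
      have "(\<Psi> \<circ> (\<Phi> \<circ> z) has_vector_derivative contact_field H (z t)) (at t within I)"
        by (simp only: field'[OF zt])
      \<comment> \<open>Agreement is available on \<open>I\<close>, where \<open>z\<close> lies in
        \<open>M\<close>; a derivative within \<open>I\<close> depends on nothing else.\<close>
      moreover have "z s = (\<Psi> \<circ> (\<Phi> \<circ> z)) s" if "s \<in> I" for s
        using inverse[OF subsetD[OF zM imageI[OF that]]] by simp
      ultimately show "(z has_vector_derivative contact_field H (z t)) (at t within I)"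
        using has_vector_derivative_transform[OF t] by blast
    qed
  qed
qed

section \<open>Smoothness of fibrewise affine maps\<close>

lemma C1_onI_open:
  assumes "open S"
    and "\<And>x. x \<in> S \<Longrightarrow> (g has_derivative g' x) (at x)"
    and "\<And>v. continuous_on S (\<lambda>x. g' x v)"
  shows "C1_on S g"
  unfolding C1_on_def using assms by (blast intro: has_derivative_at_withinI)

text \<open>With two free coefficients the family contains both the transformation and its inverse.\<close>

definition fibre_map ::
    "(real \<Rightarrow> real) \<Rightarrow> (real \<Rightarrow> real) \<Rightarrow> ('a::euclidean_space \<Rightarrow> real) \<Rightarrow> 'a phase \<Rightarrow> 'a phase" where
  "fibre_map a b h = (\<lambda>(X, P, S, t). (X, a t *\<^sub>R P + b t *\<^sub>R grad h X, a t * S + b t * h X, t))"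

text \<open>The derivative of \<open>fibre_map a b h\<close> when \<open>a'\<close> and
  \<open>b'\<close> are the derivatives of \<open>a\<close> and \<open>b\<close>. An explicit
  formula allows it to be applied to the contact form and to the contact field.\<close>

definition fibre_deriv ::
    "(real \<Rightarrow> real) \<Rightarrow> (real \<Rightarrow> real) \<Rightarrow> (real \<Rightarrow> real) \<Rightarrow> (real \<Rightarrow> real) \<Rightarrow>
     ('a::euclidean_space \<Rightarrow> real) \<Rightarrow> 'a phase \<Rightarrow> 'a phase \<Rightarrow> 'a phase" where
  "fibre_deriv a a' b b' h = (\<lambda>(X, P, S, t) (dX, dP, dS, dt).
     (dX,
      a t *\<^sub>R dP + (a' t * dt) *\<^sub>R P + b t *\<^sub>R hess h X dX + (b' t * dt) *\<^sub>R grad h X,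
      a t * dS + a' t * dt * S + b t * (grad h X \<bullet> dX) + b' t * dt * h X,
      dt))"

context bregman
begin

lemma fibre_map_has_derivative:
  assumes X: "X \<in> primal"
    and a: "(a has_real_derivative a' t) (at t)" and b: "(b has_real_derivative b' t) (at t)"
  shows "(fibre_map a b h has_derivative fibre_deriv a a' b b' h (X, P, S, t)) (at (X, P, S, t))"
proof -
  let ?z = "(X, P, S, t)"
  \<comment> \<open>Projections replace the tuple pattern so that every component is a product or
    composition of functions with known derivatives.\<close>
  let ?X = "\<lambda>z::'a phase. fst z" and ?P = "\<lambda>z::'a phase. fst (snd z)"
    and ?S = "\<lambda>z::'a phase. fst (snd (snd z))" and ?t = "\<lambda>z::'a phase. snd (snd (snd z))"
  have dX: "(?X has_derivative ?X) (at ?z)" and dP: "(?P has_derivative ?P) (at ?z)"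
    and dS: "(?S has_derivative ?S) (at ?z)" and dt: "(?t has_derivative ?t) (at ?z)"
    by (auto intro!: derivative_eq_intros)
  have da: "((\<lambda>z. a (?t z)) has_derivative (\<lambda>v. a' t * ?t v)) (at ?z)"
    by (rule has_derivative_compose[OF dt]) (use a in \<open>simp add: has_field_derivative_def\<close>)
  have db: "((\<lambda>z. b (?t z)) has_derivative (\<lambda>v. b' t * ?t v)) (at ?z)"
    by (rule has_derivative_compose[OF dt]) (use b in \<open>simp add: has_field_derivative_def\<close>)
  have dh: "((\<lambda>z. h (?X z)) has_derivative (\<lambda>v. ?X v \<bullet> grad h X)) (at ?z)"
    by (rule has_derivative_compose[OF dX]) (use GDERIV_h[OF X] in \<open>simp add: gderiv_def\<close>)
  have dg: "((\<lambda>z. grad h (?X z)) has_derivative (\<lambda>v. hess h X (?X v))) (at ?z)"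
    by (rule has_derivative_compose[OF dX]) (use has_derivative_grad[OF X] in simp)
  have "((\<lambda>z. (?X z, a (?t z) *\<^sub>R ?P z + b (?t z) *\<^sub>R grad h (?X z),
               a (?t z) * ?S z + b (?t z) * h (?X z), ?t z)) has_derivative
         (\<lambda>v. (?X v,
           (a t *\<^sub>R ?P v + (a' t * ?t v) *\<^sub>R P) + (b t *\<^sub>R hess h X (?X v) + (b' t * ?t v) *\<^sub>R grad h X),
           (a t * ?S v + (a' t * ?t v) * S) + (b t * (?X v \<bullet> grad h X) + (b' t * ?t v) * h X),
           ?t v))) (at ?z)"
    using has_derivative_Pair[OF dX has_derivative_Pair[OF
        has_derivative_add[OF has_derivative_scaleR[OF da dP] has_derivative_scaleR[OF db dg]]
        has_derivative_Pair[OF has_derivative_add[OF has_derivative_mult[OF da dS] has_derivative_mult[OF db dh]] dt]]]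
    by simp
  moreover have "fibre_map a b h = (\<lambda>z. (?X z, a (?t z) *\<^sub>R ?P z + b (?t z) *\<^sub>R grad h (?X z),
               a (?t z) * ?S z + b (?t z) * h (?X z), ?t z))"
    by (auto simp: fibre_map_def)
  moreover have "fibre_deriv a a' b b' h ?z = (\<lambda>v. (?X v,
           (a t *\<^sub>R ?P v + (a' t * ?t v) *\<^sub>R P) + (b t *\<^sub>R hess h X (?X v) + (b' t * ?t v) *\<^sub>R grad h X),
           (a t * ?S v + (a' t * ?t v) * S) + (b t * (?X v \<bullet> grad h X) + (b' t * ?t v) * h X),
           ?t v))"
    by (auto simp: fibre_deriv_def inner_commute)
  ultimately show ?thesis by (simp only:)
qed

lemma continuous_on_fibre_deriv:
  assumes M: "\<And>X P S t. (X, P, S, t) \<in> M \<Longrightarrow> X \<in> primal \<and> t \<in> T"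
    and cont: "continuous_on T a" "continuous_on T a'" "continuous_on T b" "continuous_on T b'"
  shows "continuous_on M (\<lambda>z. fibre_deriv a a' b b' h z v)"
proof -
  obtain dX dP dS dt where v: "v = (dX, dP, dS, dt)" by (cases v) auto
  have t: "continuous_on M (\<lambda>z. k (snd (snd (snd z))))" if "continuous_on T k" for k :: "real \<Rightarrow> real"
    by (rule continuous_on_compose2[OF that]) (use M in \<open>auto intro!: continuous_intros\<close>)
  have X: "continuous_on M (\<lambda>z. k (fst z))" if "continuous_on primal k" for k :: "'a \<Rightarrow> 'c::topological_space"
    by (rule continuous_on_compose2[OF that]) (use M in \<open>auto intro!: continuous_intros\<close>)
  show ?thesis
    unfolding fibre_deriv_def v split_beta fst_conv snd_conv
    by (intro continuous_intros t cont X continuous_on_h continuous_on_hess continuous_on_grad)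
qed

lemma C1_on_fibre_map:
  assumes M: "open M" "\<And>X P S t. (X, P, S, t) \<in> M \<Longrightarrow> X \<in> primal \<and> t \<in> T"
    and a: "\<And>t. t \<in> T \<Longrightarrow> (a has_real_derivative a' t) (at t)" "continuous_on T a'"
    and b: "\<And>t. t \<in> T \<Longrightarrow> (b has_real_derivative b' t) (at t)" "continuous_on T b'"
  shows "C1_on M (fibre_map a b h)"
proof (rule C1_onI_open[OF M(1)])
  show "(fibre_map a b h has_derivative fibre_deriv a a' b b' h z) (at z)" if "z \<in> M" for z
    using that M(2) a(1) b(1) by (cases z) (auto intro!: fibre_map_has_derivative)
  have cont: "continuous_on T a" "continuous_on T b"
    using a(1) b(1) by (blast intro: continuous_at_imp_continuous_on DERIV_isCont)+
  show "continuous_on M (\<lambda>z. fibre_deriv a a' b b' h z v)" for v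
    by (rule continuous_on_fibre_deriv[OF M(2) cont(1) a(2) cont(2) b(2)])
qed

end

section \<open>The two Hamiltonians, their gradients and their contact fields\<close>

locale bregman_flow = bregman C h f
  for C :: "'a::euclidean_space set" and h f :: "'a \<Rightarrow> real" +
  fixes T :: "real set" and \<alpha> \<beta> \<gamma> :: "real \<Rightarrow> real"
  assumes open_T: "open T" and cont_\<alpha>: "continuous_on T \<alpha>"
    and scaling: "\<And>t. t \<in> T \<Longrightarrow> (\<gamma> has_real_derivative exp (\<alpha> t)) (at t)"
begin

abbreviation "M \<equiv> H_domain T \<gamma> C h"
abbreviation "M' \<equiv> K_domain T C h"
abbreviation "H \<equiv> H_Br \<alpha> \<beta> \<gamma> C h f"
abbreviation "K \<equiv> K_Br \<alpha> \<beta> C h f"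

definition \<Phi> :: "'a phase \<Rightarrow> 'a phase" where
  "\<Phi> = fibre_map (\<lambda>t. exp (- \<gamma> t)) (\<lambda>t. 1) h"

text \<open>The scaling condition enters here: the derivative of \<open>exp (- \<gamma> t)\<close>
  is written with \<open>exp (\<alpha> t)\<close> in place of the derivative of
  \<open>\<gamma>\<close>.\<close>

definition \<Phi>' :: "'a phase \<Rightarrow> 'a phase \<Rightarrow> 'a phase" where
  "\<Phi>' = fibre_deriv (\<lambda>t. exp (- \<gamma> t)) (\<lambda>t. - exp (\<alpha> t) * exp (- \<gamma> t)) (\<lambda>t. 1) (\<lambda>t. 0) h"

text \<open>The inverse of \<open>\<Phi>\<close>, obtained by solving
  \<open>Q = exp (- \<gamma> t) *\<^sub>R P + grad h X\<close> for \<open>P\<close>, and likewise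
  for the last coordinate.\<close>

definition \<Psi> :: "'a phase \<Rightarrow> 'a phase" where
  "\<Psi> = fibre_map (\<lambda>t. exp (\<gamma> t)) (\<lambda>t. - exp (\<gamma> t)) h"

definition \<Psi>' :: "'a phase \<Rightarrow> 'a phase \<Rightarrow> 'a phase" where
  "\<Psi>' = fibre_deriv (\<lambda>t. exp (\<gamma> t)) (\<lambda>t. exp (\<alpha> t) * exp (\<gamma> t))
     (\<lambda>t. - exp (\<gamma> t)) (\<lambda>t. - exp (\<alpha> t) * exp (\<gamma> t)) h"

lemma cont_\<gamma>: "continuous_on T \<gamma>"
  using scaling by (blast intro: continuous_at_imp_continuous_on DERIV_isCont)

lemma M_iff: "(X, P, S, t) \<in> M \<longleftrightarrow> t \<in> T \<and> X \<in> primal \<and> exp (- \<gamma> t) *\<^sub>R P + grad h X \<in> dual"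
  by (simp add: H_domain_def)

lemma M'_iff: "(X, P, S, t) \<in> M' \<longleftrightarrow> t \<in> T \<and> X \<in> primal \<and> P \<in> dual"
  by (simp add: K_domain_def)

lemma open_M: "open M"
proof -
  let ?B = "primal \<times> (UNIV :: 'a set) \<times> (UNIV :: real set) \<times> T"
  let ?Q = "\<lambda>z::'a phase. exp (- \<gamma> (snd (snd (snd z)))) *\<^sub>R fst (snd z) + grad h (fst z)"
  have "continuous_on ?B (\<lambda>z. \<gamma> (snd (snd (snd z))))"
    by (rule continuous_on_compose2[OF cont_\<gamma>]) (auto intro!: continuous_intros)
  moreover have "continuous_on ?B (\<lambda>z. grad h (fst z))"
    by (rule continuous_on_compose2[OF continuous_on_grad]) (auto intro!: continuous_intros)
  ultimately have "continuous_on ?B ?Q"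
    by (intro continuous_intros)
  moreover have "open ?B"
    by (intro open_Times open_primal_region open_T open_UNIV)
  ultimately have "open (?B \<inter> ?Q -` dual)"
    using open_dual_region by (rule continuous_open_preimage)
  also have "?B \<inter> ?Q -` dual = M"
    by (auto simp: M_iff)
  finally show ?thesis .
qed

lemma open_M': "open M'"
proof -
  have "M' = primal \<times> dual \<times> (UNIV :: real set) \<times> T" by (auto simp: M'_iff)
  then show ?thesis
    by (simp add: open_Times open_primal_region open_dual_region open_T)
qed

text \<open>Since the transform has value \<open>grad h X \<bullet> X - h X\<close> and gradient
  \<open>X\<close> at \<open>grad h X\<close>, the Bregman divergence collapses to the Fenchel-Young
  gap of \<open>Q\<close> and \<open>X\<close>.\<close>

lemma H_eq:
  assumes "(X, P, S, t) \<in> M"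
  defines "Q \<equiv> exp (- \<gamma> t) *\<^sub>R P + grad h X"
  shows "H (X, P, S, t) = exp (\<alpha> t + \<gamma> t) * (L Q - Q \<bullet> X + h X + exp (\<beta> t) * f X)"
proof -
  have "X \<in> primal" using assms by (simp add: M_iff)
  then show ?thesis
    by (simp add: H_Br_def Q_def bregman_div_def legendre_grad grad_legendre_grad
        inner_add_left inner_add_right inner_commute)
qed

text \<open>Differentiating the closed form of \<open>H_eq\<close> avoids differentiating
  \<open>grad L\<close> along \<open>grad h\<close>. The closed form holds on \<open>M\<close>, so
  openness of its slice in \<open>X\<close> is used to transfer the derivative.\<close>

lemma GDERIV_H_X:
  assumes z: "(X, P, S, t) \<in> M"
  defines "Q \<equiv> exp (- \<gamma> t) *\<^sub>R P + grad h X"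
  shows "GDERIV (\<lambda>Y. H (Y, P, S, t)) X :>
    exp (\<alpha> t + \<gamma> t) *\<^sub>R (hess h X (grad L Q - X) - Q + grad h X + exp (\<beta> t) *\<^sub>R grad f X)"
proof -
  let ?q = "\<lambda>Y. exp (- \<gamma> t) *\<^sub>R P + grad h Y"
  have X: "X \<in> primal" and Q: "Q \<in> dual" using z by (auto simp: M_iff Q_def)
  have dq: "(?q has_derivative hess h X) (at X)"
    using has_derivative_grad[OF X] by (auto intro!: derivative_eq_intros)
  have dL: "((\<lambda>Y. L (?q Y)) has_derivative (\<lambda>v. hess h X v \<bullet> grad L Q)) (at X)"
    by (rule has_derivative_compose[OF dq]) (use GDERIV_legendre[OF Q] in \<open>simp add: gderiv_def Q_def\<close>)
  have dh: "(h has_derivative (\<lambda>v. v \<bullet> grad h X)) (at X)"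
    and df: "(f has_derivative (\<lambda>v. v \<bullet> grad f X)) (at X)"
    using GDERIV_h[OF X] GDERIV_f[OF X] by (simp_all add: gderiv_def)
  have "((\<lambda>Y. exp (\<alpha> t + \<gamma> t) * (L (?q Y) - ?q Y \<bullet> Y + h Y + exp (\<beta> t) * f Y)) has_derivative
     (\<lambda>v. exp (\<alpha> t + \<gamma> t) * (hess h X v \<bullet> grad L Q - (?q X \<bullet> v + hess h X v \<bullet> X)
        + v \<bullet> grad h X + exp (\<beta> t) * (v \<bullet> grad f X)))) (at X)"
    by (intro has_derivative_mult_right has_derivative_add has_derivative_diff dL dh df
        has_derivative_inner[OF dq has_derivative_ident])
  also have "(\<lambda>v. exp (\<alpha> t + \<gamma> t) * (hess h X v \<bullet> grad L Q - (?q X \<bullet> v + hess h X v \<bullet> X)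
        + v \<bullet> grad h X + exp (\<beta> t) * (v \<bullet> grad f X))) =
      (\<lambda>v. v \<bullet> (exp (\<alpha> t + \<gamma> t) *\<^sub>R
        (hess h X (grad L Q - X) - Q + grad h X + exp (\<beta> t) *\<^sub>R grad f X)))"
  proof (rule ext)
    fix v
    \<comment> \<open>Symmetry of the Hessian moves it off \<open>v\<close>, so that the derivative
      takes the form of an inner product with a gradient.\<close>
    have "hess h X v \<bullet> grad L Q - hess h X v \<bullet> X = v \<bullet> hess h X (grad L Q - X)"
      by (simp add: hess_symmetric[OF X, symmetric] inner_diff_right)
    then show "exp (\<alpha> t + \<gamma> t) * (hess h X v \<bullet> grad L Q - (?q X \<bullet> v + hess h X v \<bullet> X)
        + v \<bullet> grad h X + exp (\<beta> t) * (v \<bullet> grad f X)) =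
      v \<bullet> (exp (\<alpha> t + \<gamma> t) *\<^sub>R
        (hess h X (grad L Q - X) - Q + grad h X + exp (\<beta> t) *\<^sub>R grad f X))"
      unfolding Q_def[symmetric]
      by (simp add: inner_add_right inner_diff_right inner_commute[of v Q])
  qed
  finally have "((\<lambda>Y. exp (\<alpha> t + \<gamma> t) * (L (?q Y) - ?q Y \<bullet> Y + h Y + exp (\<beta> t) * f Y)) has_derivative
     (\<lambda>v. v \<bullet> (exp (\<alpha> t + \<gamma> t) *\<^sub>R
        (hess h X (grad L Q - X) - Q + grad h X + exp (\<beta> t) *\<^sub>R grad f X)))) (at X)" .
  moreover have "open ((\<lambda>Y. (Y, P, S, t)) -` M)"
    by (intro open_vimage open_M continuous_intros)
  ultimately show ?thesis
    unfolding gderiv_def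
    by (rule has_derivative_transform_within_open) (use z in \<open>simp_all add: H_eq\<close>)
qed

text \<open>The factor \<open>exp (- \<gamma> t)\<close> from the chain rule cancels
  \<open>exp (\<gamma> t)\<close> in the prefactor, leaving the velocity that \<open>K\<close> has
  at momentum \<open>Q\<close>.\<close>

lemma GDERIV_H_P:
  assumes z: "(X, P, S, t) \<in> M"
  defines "Q \<equiv> exp (- \<gamma> t) *\<^sub>R P + grad h X"
  shows "GDERIV (\<lambda>R. H (X, R, S, t)) P :> exp (\<alpha> t) *\<^sub>R (grad L Q - X)"
proof -
  let ?q = "\<lambda>R. exp (- \<gamma> t) *\<^sub>R R + grad h X"
  have Q: "Q \<in> dual" using z by (auto simp: M_iff Q_def)
  have dq: "(?q has_derivative (\<lambda>v. exp (- \<gamma> t) *\<^sub>R v)) (at P)"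
    by (auto intro!: derivative_eq_intros)
  have dL: "((\<lambda>R. L (?q R)) has_derivative (\<lambda>v. (exp (- \<gamma> t) *\<^sub>R v) \<bullet> grad L Q)) (at P)"
    by (rule has_derivative_compose[OF dq]) (use GDERIV_legendre[OF Q] in \<open>simp add: gderiv_def Q_def\<close>)
  have "((\<lambda>R. exp (\<alpha> t + \<gamma> t) * (L (?q R) - ?q R \<bullet> X + (h X + exp (\<beta> t) * f X))) has_derivative
     (\<lambda>v. exp (\<alpha> t + \<gamma> t) * ((exp (- \<gamma> t) *\<^sub>R v) \<bullet> grad L Q - (exp (- \<gamma> t) *\<^sub>R v) \<bullet> X + 0))) (at P)"
    by (intro has_derivative_mult_right has_derivative_add has_derivative_diff dL has_derivative_const
        has_derivative_inner_left dq)
  also have "(\<lambda>v. exp (\<alpha> t + \<gamma> t) * ((exp (- \<gamma> t) *\<^sub>R v) \<bullet> grad L Q - (exp (- \<gamma> t) *\<^sub>R v) \<bullet> X + 0)) =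
      (\<lambda>v. v \<bullet> (exp (\<alpha> t) *\<^sub>R (grad L Q - X)))"
    by (rule ext) (simp add: exp_add exp_minus inner_diff_right field_simps)
  finally have "((\<lambda>R. exp (\<alpha> t + \<gamma> t) * (L (?q R) - ?q R \<bullet> X + (h X + exp (\<beta> t) * f X))) has_derivative
     (\<lambda>v. v \<bullet> (exp (\<alpha> t) *\<^sub>R (grad L Q - X)))) (at P)" .
  moreover have "open ((\<lambda>R. (X, R, S, t)) -` M)"
    by (intro open_vimage open_M continuous_intros)
  ultimately show ?thesis
    unfolding gderiv_def
    by (rule has_derivative_transform_within_open) (use z in \<open>simp_all add: H_eq\<close>)
qed

lemma DERIV_H_S: "((\<lambda>s. H (X, P, s, t)) has_real_derivative 0) (at S)"
  by (simp add: H_Br_def)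

lemma GDERIV_K_X:
  assumes "X \<in> primal"
  shows "GDERIV (\<lambda>Y. K (Y, P, S, t)) X :> exp (\<alpha> t) *\<^sub>R (exp (\<beta> t) *\<^sub>R grad f X - P)"
proof -
  have df: "(f has_derivative (\<lambda>v. v \<bullet> grad f X)) (at X)"
    using GDERIV_f[OF assms] by (simp add: gderiv_def)
  have "((\<lambda>Y. K (Y, P, S, t)) has_derivative
      (\<lambda>v. exp (\<alpha> t) * (0 - P \<bullet> v + exp (\<beta> t) * (v \<bullet> grad f X) + 0))) (at X)"
    unfolding K_Br_def prod.case
    by (intro has_derivative_mult_right has_derivative_add has_derivative_diff df has_derivative_const
        has_derivative_inner_right has_derivative_ident)
  then show ?thesis
    by (simp add: gderiv_def inner_diff_right inner_commute[of P] algebra_simps)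
qed

lemma GDERIV_K_P:
  assumes "P \<in> dual"
  shows "GDERIV (\<lambda>R. K (X, R, S, t)) P :> exp (\<alpha> t) *\<^sub>R (grad L P - X)"
proof -
  have dL: "(L has_derivative (\<lambda>v. v \<bullet> grad L P)) (at P)"
    using GDERIV_legendre[OF assms] by (simp add: gderiv_def)
  have "((\<lambda>R. K (X, R, S, t)) has_derivative
      (\<lambda>v. exp (\<alpha> t) * (v \<bullet> grad L P - v \<bullet> X + 0 + 0))) (at P)"
    unfolding K_Br_def prod.case
    by (intro has_derivative_mult_right has_derivative_add has_derivative_diff dL has_derivative_const
        has_derivative_inner_left has_derivative_ident)
  then show ?thesis
    by (simp add: gderiv_def inner_diff_right)
qed

lemma DERIV_K_S: "((\<lambda>s. K (X, P, s, t)) has_real_derivative exp (\<alpha> t)) (at S)"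
  unfolding K_Br_def by (auto intro!: derivative_eq_intros)

lemma contact_field_H:
  assumes z: "(X, P, S, t) \<in> M"
  defines "Q \<equiv> exp (- \<gamma> t) *\<^sub>R P + grad h X"
  shows "contact_field H (X, P, S, t) =
    (exp (\<alpha> t) *\<^sub>R (grad L Q - X),
     - (exp (\<alpha> t + \<gamma> t) *\<^sub>R (hess h X (grad L Q - X) - Q + grad h X + exp (\<beta> t) *\<^sub>R grad f X)),
     (exp (\<alpha> t) *\<^sub>R (grad L Q - X)) \<bullet> P
       - exp (\<alpha> t + \<gamma> t) * (L Q - Q \<bullet> X + h X + exp (\<beta> t) * f X),
     1)"
  unfolding contact_field_def prod.case Let_def grad_eqI[OF GDERIV_H_X[OF z]]
    grad_eqI[OF GDERIV_H_P[OF z]] DERIV_imp_deriv[OF DERIV_H_S] H_eq[OF z] Q_def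
  by simp

text \<open>In the momentum component the bilinear term and the friction term in \<open>P\<close>
  cancel. They are kept apart, as this is the shape reached when the transformed field is
  computed.\<close>

lemma contact_field_K:
  assumes "(X, P, S, t) \<in> M'"
  shows "contact_field K (X, P, S, t) =
    (exp (\<alpha> t) *\<^sub>R (grad L P - X),
     - (exp (\<alpha> t) *\<^sub>R (exp (\<beta> t) *\<^sub>R grad f X - P)) - exp (\<alpha> t) *\<^sub>R P,
     (exp (\<alpha> t) *\<^sub>R (grad L P - X)) \<bullet> P - exp (\<alpha> t) * (L P - P \<bullet> X + exp (\<beta> t) * f X + S),
     1)"
proof -
  have X: "X \<in> primal" and P: "P \<in> dual" using assms by (auto simp: M'_iff)
  show ?thesis
    unfolding contact_field_def prod.case Let_def grad_eqI[OF GDERIV_K_X[OF X]]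
      grad_eqI[OF GDERIV_K_P[OF P]] DERIV_imp_deriv[OF DERIV_K_S]
    by (simp add: K_Br_def)
qed

end

lemma GDERIV_imp_differentiable: "GDERIV g x :> D \<Longrightarrow> g differentiable at x"
  by (auto simp: gderiv_def differentiable_def)

text \<open>Serves to pass smoothness from the explicit inverse \<open>\<Psi>\<close> to
  \<open>inv_into M \<Phi>\<close>, which is identified with it on \<open>M'\<close>.\<close>

lemma C1_on_transform:
  assumes g: "C1_on S g" and eq: "\<And>x. x \<in> S \<Longrightarrow> k x = g x"
  shows "C1_on S k"
proof -
  obtain g' where g': "\<And>x. x \<in> S \<Longrightarrow> (g has_derivative g' x) (at x within S)"
    and cont: "\<forall>v. continuous_on S (\<lambda>x. g' x v)"
    using g by (auto simp: C1_on_def)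
  have "(k has_derivative g' x) (at x within S)" if "x \<in> S" for x
    by (rule has_derivative_transform[OF that eq g'[OF that]])
  with cont show ?thesis by (auto simp: C1_on_def)
qed

section \<open>The contact form and the dynamics under the transformation\<close>

context bregman_flow
begin

lemma contact_hamiltonian_H: "contact_hamiltonian M H"
proof -
  have "(\<lambda>Y. H (Y, P, S, t)) differentiable (at X)" "(\<lambda>R. H (X, R, S, t)) differentiable (at P)"
    "(\<lambda>s. H (X, P, s, t)) differentiable (at S)" if "(X, P, S, t) \<in> M" for X P S t
    using GDERIV_imp_differentiable[OF GDERIV_H_X[OF that]] GDERIV_imp_differentiable[OF GDERIV_H_P[OF that]]
      real_differentiable_def[THEN iffD2, OF exI, OF DERIV_H_S] .
  then show ?thesis
    unfolding contact_hamiltonian_def using open_M by fast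
qed

lemma contact_hamiltonian_K: "contact_hamiltonian M' K"
proof -
  have "(\<lambda>Y. K (Y, P, S, t)) differentiable (at X)" "(\<lambda>R. K (X, R, S, t)) differentiable (at P)"
    "(\<lambda>s. K (X, P, s, t)) differentiable (at S)" if z: "(X, P, S, t) \<in> M'" for X P S t
  proof -
    have X: "X \<in> primal" and P: "P \<in> dual" using z by (auto simp: M'_iff)
    show "(\<lambda>Y. K (Y, P, S, t)) differentiable (at X)" "(\<lambda>R. K (X, R, S, t)) differentiable (at P)"
      "(\<lambda>s. K (X, P, s, t)) differentiable (at S)"
      using GDERIV_imp_differentiable[OF GDERIV_K_X[OF X]] GDERIV_imp_differentiable[OF GDERIV_K_P[OF P]]
        real_differentiable_def[THEN iffD2, OF exI, OF DERIV_K_S] .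
  qed
  then show ?thesis
    unfolding contact_hamiltonian_def using open_M' by fast
qed

lemma \<Phi>_apply: "\<Phi> (X, P, S, t) = (X, exp (- \<gamma> t) *\<^sub>R P + grad h X, exp (- \<gamma> t) * S + h X, t)"
  by (simp add: \<Phi>_def fibre_map_def)

lemma \<Psi>_apply: "\<Psi> (X, P, S, t) = (X, exp (\<gamma> t) *\<^sub>R (P - grad h X), exp (\<gamma> t) * (S - h X), t)"
  by (simp add: \<Psi>_def fibre_map_def algebra_simps)

lemma exp_cancel: "exp (\<gamma> t) * exp (- \<gamma> t) = 1" "exp (- \<gamma> t) * exp (\<gamma> t) = 1"
  by (simp_all flip: exp_add)

lemma \<Phi>_into: "z \<in> M \<Longrightarrow> \<Phi> z \<in> M'"
  by (cases z) (simp add: \<Phi>_apply M_iff M'_iff)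

lemma \<Psi>_into: "w \<in> M' \<Longrightarrow> \<Psi> w \<in> M"
  by (cases w) (simp add: \<Psi>_apply M_iff M'_iff exp_cancel)

lemma \<Psi>_\<Phi>: "\<Psi> (\<Phi> z) = z"
  by (cases z) (simp add: \<Phi>_apply \<Psi>_apply exp_cancel flip: mult.assoc)

lemma \<Phi>_\<Psi>: "\<Phi> (\<Psi> w) = w"
  by (cases w) (simp add: \<Phi>_apply \<Psi>_apply exp_cancel flip: mult.assoc)

lemma bij_\<Phi>: "bij_betw \<Phi> M M'"
  by (rule bij_betwI[of \<Phi> _ _ \<Psi>]) (auto simp: \<Phi>_into \<Psi>_into \<Psi>_\<Phi> \<Phi>_\<Psi> simp del: prod.inject)

lemma inv_into_\<Phi>: "w \<in> M' \<Longrightarrow> inv_into M \<Phi> w = \<Psi> w"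
  using inv_into_f_eq[OF bij_betw_imp_inj_on[OF bij_\<Phi>] \<Psi>_into \<Phi>_\<Psi>] by blast

lemma time_\<Phi>: "time_of (\<Phi> z) = time_of z"
  by (cases z) (simp add: \<Phi>_apply time_of_def)

lemma DERIV_exp_minus_\<gamma>:
  "t \<in> T \<Longrightarrow> ((\<lambda>t. exp (- \<gamma> t)) has_real_derivative - exp (\<alpha> t) * exp (- \<gamma> t)) (at t)"
  using scaling by (auto intro!: derivative_eq_intros)

lemma DERIV_exp_\<gamma>: "t \<in> T \<Longrightarrow> ((\<lambda>t. exp (\<gamma> t)) has_real_derivative exp (\<alpha> t) * exp (\<gamma> t)) (at t)"
  using scaling by (auto intro!: derivative_eq_intros)

lemma DERIV_minus_exp_\<gamma>:
  "t \<in> T \<Longrightarrow> ((\<lambda>t. - exp (\<gamma> t)) has_real_derivative - exp (\<alpha> t) * exp (\<gamma> t)) (at t)"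
  using scaling by (auto intro!: derivative_eq_intros)

lemma \<Phi>_has_derivative: "z \<in> M \<Longrightarrow> (\<Phi> has_derivative \<Phi>' z) (at z)"
  unfolding \<Phi>_def \<Phi>'_def
  by (cases z) (auto simp: M_iff intro!: fibre_map_has_derivative DERIV_exp_minus_\<gamma>[simplified])

lemma \<Psi>_has_derivative: "w \<in> M' \<Longrightarrow> (\<Psi> has_derivative \<Psi>' w) (at w)"
  unfolding \<Psi>_def \<Psi>'_def
  by (cases w) (auto simp: M'_iff intro!: fibre_map_has_derivative DERIV_exp_\<gamma> DERIV_minus_exp_\<gamma>[simplified])

lemma C1_\<Phi>: "C1_on M \<Phi>"
  unfolding \<Phi>_def
proof (rule C1_on_fibre_map[OF open_M _ DERIV_exp_minus_\<gamma> _ DERIV_const])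
  show "continuous_on T (\<lambda>t. - exp (\<alpha> t) * exp (- \<gamma> t))" "continuous_on T (\<lambda>t. 0 :: real)"
    by (intro continuous_intros cont_\<alpha> cont_\<gamma>)+
qed (simp_all add: M_iff)

lemma C1_\<Psi>: "C1_on M' \<Psi>"
  unfolding \<Psi>_def
proof (rule C1_on_fibre_map[OF open_M' _ DERIV_exp_\<gamma> _ DERIV_minus_exp_\<gamma>])
  show "continuous_on T (\<lambda>t. exp (\<alpha> t) * exp (\<gamma> t))"
    "continuous_on T (\<lambda>t. - exp (\<alpha> t) * exp (\<gamma> t))"
    by (intro continuous_intros cont_\<alpha> cont_\<gamma>)+
qed (simp_all add: M'_iff)

text \<open>The terms \<open>grad h X \<bullet> dX\<close> from the new \<open>S\<close> and from
  the new \<open>P\<close> cancel. In the coefficient of \<open>dt\<close> the derivative of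
  \<open>exp (- \<gamma> t) * S\<close> cancels the \<open>S\<close> part of \<open>K\<close>, and
  what remains is \<open>exp (- \<gamma> t) * H z\<close>.\<close>

lemma contact_form_\<Phi>:
  assumes z: "z \<in> M"
  shows "contact_form K (\<Phi> z) (\<Phi>' z v) = exp (- \<gamma> (time_of z)) * contact_form H z v"
proof -
  obtain X P S t where zeq: "z = (X, P, S, t)" by (cases z) auto
  obtain dX dP dS dt where v: "v = (dX, dP, dS, dt)" by (cases v) auto
  let ?Q = "exp (- \<gamma> t) *\<^sub>R P + grad h X"
  have "exp (- \<gamma> t) * H z = exp (\<alpha> t) * (L ?Q - ?Q \<bullet> X + h X + exp (\<beta> t) * f X)"
    using z unfolding zeq by (simp add: H_eq exp_add exp_minus)
  moreover have "contact_form K (\<Phi> z) (\<Phi>' z v) =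
      exp (- \<gamma> t) * (dS - P \<bullet> dX)
        + (exp (\<alpha> t) * (L ?Q - ?Q \<bullet> X + h X + exp (\<beta> t) * f X)) * dt"
    by (simp add: zeq v contact_form_def \<Phi>_apply \<Phi>'_def fibre_deriv_def K_Br_def
        inner_add_left algebra_simps)
  ultimately have "contact_form K (\<Phi> z) (\<Phi>' z v) = exp (- \<gamma> t) * (dS - P \<bullet> dX) + (exp (- \<gamma> t) * H z) * dt"
    by (simp only:)
  then show ?thesis
    by (simp add: zeq v contact_form_def time_of_def algebra_simps)
qed

text \<open>The Hessian terms cancel: \<open>- hess h X (grad L Q - X)\<close> from \<open>dP/dt\<close> against \<open>hess h X (dX/dt)\<close>
  from the shift of the momentum.\<close>

lemma \<Phi>'_contact_field:
  assumes z: "z \<in> M"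
  shows "\<Phi>' z (contact_field H z) = contact_field K (\<Phi> z)"
proof -
  obtain X P S t where zeq: "z = (X, P, S, t)" by (cases z) auto
  define Q where "Q = exp (- \<gamma> t) *\<^sub>R P + grad h X"
  define e where "e = exp (- \<gamma> t)"
  have zM: "(X, P, S, t) \<in> M" using z zeq by simp
  have X: "X \<in> primal" using zM by (simp add: M_iff)
  interpret A: bounded_linear "hess h X"
    using has_derivative_grad[OF X] by (rule has_derivative_bounded_linear)
  have E: "exp (\<alpha> t + \<gamma> t) = exp (\<alpha> t) * exp (\<gamma> t)" by (rule exp_add)
  have ee: "e * exp (\<gamma> t) = 1" by (simp add: e_def exp_cancel)
  have Q: "Q = e *\<^sub>R P + grad h X" by (simp add: Q_def e_def)
  have cancel: "e * (exp (\<alpha> t) * exp (\<gamma> t) * x) = exp (\<alpha> t) * x" for x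
    using ee by (metis mult.assoc mult.commute mult_1)
  have \<Phi>z: "\<Phi> (X, P, S, t) = (X, Q, e * S + h X, t)"
    by (simp add: \<Phi>_apply Q_def e_def)
  have "(X, Q, e * S + h X, t) \<in> M'" using \<Phi>_into[OF zM] unfolding \<Phi>z .
  note K = contact_field_K[OF this]
  note H = contact_field_H[OF zM, folded Q_def, unfolded E]
  \<comment> \<open>The left sides of \<open>P\<close> and \<open>S\<close> have literally the shape
    left by unfolding \<open>fibre_deriv\<close> at a vector with time component 1, hence the
    factors 1 and 0; the last step rewrites with both equations.\<close>
  have P: "e *\<^sub>R (- ((exp (\<alpha> t) * exp (\<gamma> t)) *\<^sub>R
        (hess h X (grad L Q - X) - Q + grad h X + exp (\<beta> t) *\<^sub>R grad f X)))
      + ((- exp (\<alpha> t) * e) * 1) *\<^sub>R P + 1 *\<^sub>R hess h X (exp (\<alpha> t) *\<^sub>R (grad L Q - X)) + (0 * 1) *\<^sub>R grad h X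
    = - (exp (\<alpha> t) *\<^sub>R (exp (\<beta> t) *\<^sub>R grad f X - Q)) - exp (\<alpha> t) *\<^sub>R Q" (is "?l = ?r")
  proof -
    have "?l = - (exp (\<alpha> t) *\<^sub>R (hess h X (grad L Q - X) - Q + grad h X + exp (\<beta> t) *\<^sub>R grad f X))
      - exp (\<alpha> t) *\<^sub>R e *\<^sub>R P + exp (\<alpha> t) *\<^sub>R hess h X (grad L Q - X)"
      using cancel[of 1] by (simp add: A.scaleR)
    also have "\<dots> = ?r" by (simp add: Q algebra_simps)
    finally show ?thesis .
  qed
  have S: "e * ((exp (\<alpha> t) *\<^sub>R (grad L Q - X)) \<bullet> P
       - exp (\<alpha> t) * exp (\<gamma> t) * (L Q - Q \<bullet> X + h X + exp (\<beta> t) * f X))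
      + (- exp (\<alpha> t) * e) * 1 * S + 1 * (grad h X \<bullet> (exp (\<alpha> t) *\<^sub>R (grad L Q - X))) + 0 * 1 * h X
    = (exp (\<alpha> t) *\<^sub>R (grad L Q - X)) \<bullet> Q
      - exp (\<alpha> t) * (L Q - Q \<bullet> X + exp (\<beta> t) * f X + (e * S + h X))" (is "?l = ?r")
  proof -
    \<comment> \<open>Splitting \<open>Q\<close> produces the term
      \<open>grad h X \<bullet> dX/dt\<close> contributed by the summand \<open>h X\<close> of the
      new last coordinate.\<close>
    have "(exp (\<alpha> t) *\<^sub>R (grad L Q - X)) \<bullet> Q =
        e * ((exp (\<alpha> t) *\<^sub>R (grad L Q - X)) \<bullet> P) + grad h X \<bullet> (exp (\<alpha> t) *\<^sub>R (grad L Q - X))"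
      by (subst (2) Q) (simp add: inner_add_right inner_commute algebra_simps)
    then show ?thesis
      unfolding right_diff_distrib[of e] cancel by (simp add: algebra_simps)
  qed
  show ?thesis
    unfolding zeq \<Phi>z K H \<Phi>'_def fibre_deriv_def prod.case e_def[symmetric] P S by simp
qed

lemma contact_equivalence: "contact_equivalent M H M' K"
  unfolding contact_equivalent_def
proof (intro conjI exI)
  show "contact_hamiltonian M H" by (rule contact_hamiltonian_H)
  show "contact_hamiltonian M' K" by (rule contact_hamiltonian_K)
  have "C1_on M' (inv_into M \<Phi>)"
    by (rule C1_on_transform[OF C1_\<Psi> inv_into_\<Phi>])
  moreover have "contact_form K (\<Phi> z) (frechet_derivative \<Phi> (at z) v) =
      exp (- \<gamma> (time_of z)) * contact_form H z v" if "z \<in> M" for z v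
    using contact_form_\<Phi>[OF that] frechet_derivative_at[OF \<Phi>_has_derivative[OF that]] by simp
  ultimately show "contact_transformation M H M' K \<Phi> (\<lambda>z. exp (- \<gamma> (time_of z)))"
    unfolding contact_transformation_def using bij_\<Phi> C1_\<Phi> time_\<Phi> by simp
  show "preserves_dynamics M H M' K \<Phi>"
    by (rule preserves_dynamicsI[OF open_M \<Phi>_has_derivative \<Psi>_has_derivative \<Phi>_into \<Psi>_\<Phi> time_\<Phi>
          \<Phi>'_contact_field])
qed

end

lemma separable_K_Br: "separable_on N (K_Br \<alpha> \<beta> C h f)"
  unfolding separable_on_def K_Br_def
  by (rule exI[of _ "\<lambda>P t. exp (\<alpha> t) * legendre C h P"],
      rule exI[of _ "\<lambda>X t. exp (\<alpha> t) * (exp (\<beta> t) * f X)"],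
      rule exI[of _ "\<lambda>t. exp (\<alpha> t)"], rule exI[of _ "\<lambda>t. - exp (\<alpha> t)"])
     (auto simp: algebra_simps)

subsection \<open>A non-separable Bregman Hamiltonian\<close>

definition hyp :: "'a::euclidean_space \<Rightarrow> real" where
  "hyp x = sqrt (1 + x \<bullet> x)"

text \<open>This view reduces convexity to the triangle inequality and the bound on the transform to
  Cauchy-Schwarz, both in one dimension more.\<close>

lemma hyp_eq_norm: "hyp x = norm (1 :: real, x)"
  by (simp add: hyp_def norm_eq_sqrt_inner)

lemma hyp_pos: "hyp x > 0"
  unfolding hyp_def by (simp add: add_pos_nonneg)

lemma hyp_square: "hyp x * hyp x = 1 + x \<bullet> x"
  unfolding hyp_def by simp

lemma GDERIV_inner_self: "GDERIV (\<lambda>x. x \<bullet> x) x :> 2 *\<^sub>R x"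
proof -
  have "((\<lambda>x. x \<bullet> x) has_derivative (\<lambda>v. x \<bullet> v + v \<bullet> x)) (at x)"
    by (intro has_derivative_inner has_derivative_ident)
  then show ?thesis by (simp add: gderiv_def inner_commute)
qed

lemma GDERIV_hyp: "GDERIV hyp x :> x /\<^sub>R hyp x"
proof -
  have "(sqrt has_real_derivative inverse (sqrt (1 + x \<bullet> x)) / 2) (at (1 + x \<bullet> x))"
    by (intro DERIV_real_sqrt add_pos_nonneg) simp_all
  from GDERIV_DERIV_compose[OF GDERIV_add[OF GDERIV_const GDERIV_inner_self] this]
  show ?thesis by (simp add: hyp_def[abs_def])
qed

lemma grad_hyp: "grad hyp x = x /\<^sub>R hyp x"
  by (rule grad_eqI[OF GDERIV_hyp])

lemma continuous_on_hyp: "continuous_on S hyp"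
  unfolding hyp_def[abs_def] by (intro continuous_intros)

lemma C1_on_hyp: "C1_on UNIV hyp"
proof (rule C1_onI_open[OF open_UNIV])
  show "(hyp has_derivative (\<lambda>v. v \<bullet> (x /\<^sub>R hyp x))) (at x)" for x :: 'a
    using GDERIV_hyp by (simp only: gderiv_def)
  show "continuous_on UNIV (\<lambda>x. v \<bullet> (x /\<^sub>R hyp x))" for v :: 'a
    by (intro continuous_intros continuous_on_hyp) (simp add: hyp_pos[THEN less_imp_neq, symmetric])
qed

lemma C1_on_grad_hyp: "C1_on UNIV (grad hyp)"
proof -
  let ?D = "\<lambda>x v. inverse (hyp x) *\<^sub>R v + (v \<bullet> (- (inverse (hyp x))\<^sup>2 *\<^sub>R (x /\<^sub>R hyp x))) *\<^sub>R x"
  have "((\<lambda>x. inverse (hyp x) *\<^sub>R x) has_derivative ?D x) (at x)" for x :: 'a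
    using GDERIV_inverse[OF GDERIV_hyp hyp_pos[THEN less_imp_neq, symmetric], of x]
    unfolding gderiv_def by (rule has_derivative_scaleR) (rule has_derivative_ident)
  then have "(grad hyp has_derivative ?D x) (at x)" for x :: 'a
    unfolding grad_hyp[abs_def] .
  moreover have "continuous_on UNIV (\<lambda>x. ?D x v)" for v :: 'a
    by (intro continuous_intros continuous_on_hyp) (auto simp: hyp_pos[THEN less_imp_neq, symmetric])
  ultimately show ?thesis
    by (rule C1_onI_open[OF open_UNIV])
qed

lemma convex_on_hyp: "convex_on UNIV hyp"
proof (rule convex_onI)
  fix s :: real and x y :: 'a
  assume s: "0 < s" "s < 1"
  have "hyp ((1 - s) *\<^sub>R x + s *\<^sub>R y) = norm ((1 - s) *\<^sub>R (1 :: real, x) + s *\<^sub>R (1, y))"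
    by (simp add: hyp_eq_norm)
  also have "\<dots> \<le> norm ((1 - s) *\<^sub>R (1 :: real, x)) + norm (s *\<^sub>R (1 :: real, y))"
    by (rule norm_triangle_ineq)
  also have "\<dots> = (1 - s) * hyp x + s * hyp y"
    unfolding norm_scaleR hyp_eq_norm using s by simp
  finally show "hyp ((1 - s) *\<^sub>R x + s *\<^sub>R y) \<le> (1 - s) * hyp x + s * hyp y" .
qed simp

text \<open>The same function serves as \<open>h\<close> and as the objective, with minimizer
  0.\<close>

lemma bregman_data_hyp: "bregman_data (UNIV :: 'a::euclidean_space set) hyp hyp"
proof -
  have "\<exists>!x::'a. x \<in> UNIV \<and> (\<forall>y\<in>UNIV :: 'a set. hyp x \<le> hyp y)"
  proof (rule ex1I[of _ 0])
    fix x :: 'a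
    assume "x \<in> UNIV \<and> (\<forall>y\<in>UNIV :: 'a set. hyp x \<le> hyp y)"
    then have "hyp x \<le> hyp (0 :: 'a)" by simp
    then have "x \<bullet> x \<le> 0" by (simp add: hyp_def)
    then show "x = 0" by (metis inner_eq_zero_iff inner_ge_zero antisym)
  qed (simp add: hyp_def)
  \<comment> \<open>The blow-up condition at the boundary is vacuous, as the whole space has empty
    frontier.\<close>
  moreover have "essentially_smooth_on (UNIV :: 'a set) hyp"
    using GDERIV_imp_differentiable[OF GDERIV_hyp] by (auto simp: essentially_smooth_on_def)
  ultimately show ?thesis
    using C1_on_hyp convex_on_hyp by (simp add: bregman_data_def)
qed

text \<open>Cauchy-Schwarz for the unit vector \<open>(sqrt (1 - P \<bullet> P), P)\<close> against
  \<open>(1, V)\<close>.\<close>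

lemma inner_le_hyp:
  assumes "P \<bullet> P < 1"
  shows "P \<bullet> V - hyp V \<le> - sqrt (1 - P \<bullet> P)"
proof -
  have "(sqrt (1 - P \<bullet> P), P) \<bullet> (1 :: real, V) \<le> norm (sqrt (1 - P \<bullet> P), P) * norm (1 :: real, V)"
    by (rule norm_cauchy_schwarz)
  also have "norm (sqrt (1 - P \<bullet> P), P) = 1"
    using assms by (simp add: norm_eq_sqrt_inner)
  finally show ?thesis by (simp add: hyp_eq_norm)
qed

lemma legendre_hyp:
  assumes P: "P \<bullet> P < 1"
  shows "legendre UNIV hyp P = - sqrt (1 - P \<bullet> P)"
proof (rule antisym)
  show "legendre UNIV hyp P \<le> - sqrt (1 - P \<bullet> P)"
    unfolding legendre_def by (rule cSUP_least) (simp_all add: inner_le_hyp[OF P])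
  \<comment> \<open>At \<open>V = P /\<^sub>R s\<close> the vectors \<open>(s, P)\<close> and
    \<open>(1, V)\<close> are parallel, so Cauchy-Schwarz is an equality and the supremum is
    attained.\<close>
  define s where "s = sqrt (1 - P \<bullet> P)"
  have s: "s > 0" "s * s = 1 - P \<bullet> P" using P by (simp_all add: s_def)
  have "hyp (P /\<^sub>R s) = 1 / s"
  proof -
    have "1 + (P /\<^sub>R s) \<bullet> (P /\<^sub>R s) = (1 / s) * (1 / s)"
      using s by (simp add: field_simps)
    then show ?thesis
      unfolding hyp_def using s by (intro real_sqrt_unique) (simp_all only: power2_eq_square, simp)
  qed
  then have "P \<bullet> (P /\<^sub>R s) - hyp (P /\<^sub>R s) = - s"
    using s by (simp add: field_simps)
  moreover have "P \<bullet> (P /\<^sub>R s) - hyp (P /\<^sub>R s) \<le> legendre UNIV hyp P"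
    unfolding legendre_def
    by (rule cSUP_upper) (auto intro!: bdd_aboveI2 inner_le_hyp[OF P])
  ultimately show "- sqrt (1 - P \<bullet> P) \<le> legendre UNIV hyp P"
    by (simp add: s_def)
qed

lemma dual_region_hyp:
  assumes "P \<bullet> P < 1"
  shows "P \<in> dual_region UNIV (hyp :: 'a::euclidean_space \<Rightarrow> real)"
proof -
  let ?B = "{P :: 'a. P \<bullet> P < 1}"
  have B: "open ?B" by (intro open_Collect_less continuous_intros)
  have "legendre UNIV hyp differentiable (at P)" if "P \<in> ?B" for P :: 'a
  proof -
    have "GDERIV (\<lambda>P. 1 - P \<bullet> P) P :> 0 - 2 *\<^sub>R P"
      by (intro GDERIV_diff GDERIV_const GDERIV_inner_self)
    moreover have "(sqrt has_real_derivative inverse (sqrt (1 - P \<bullet> P)) / 2) (at (1 - P \<bullet> P))"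
      using that by (intro DERIV_real_sqrt) simp
    ultimately have "GDERIV (\<lambda>P. sqrt (1 - P \<bullet> P)) P :> (inverse (sqrt (1 - P \<bullet> P)) / 2) *\<^sub>R (0 - 2 *\<^sub>R P)"
      by (rule GDERIV_DERIV_compose)
    then have "((\<lambda>P. - sqrt (1 - P \<bullet> P)) has_derivative
        (\<lambda>v. v \<bullet> - ((inverse (sqrt (1 - P \<bullet> P)) / 2) *\<^sub>R (0 - 2 *\<^sub>R P)))) (at P)"
      using GDERIV_minus unfolding gderiv_def by blast
    then have "(legendre UNIV hyp has_derivative
        (\<lambda>v. v \<bullet> - ((inverse (sqrt (1 - P \<bullet> P)) / 2) *\<^sub>R (0 - 2 *\<^sub>R P)))) (at P)"
      by (rule has_derivative_transform_within_open[OF _ B that]) (simp add: legendre_hyp)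
    then show ?thesis by (auto simp: differentiable_def)
  qed
  moreover have "bdd_above (range (\<lambda>V. P \<bullet> V - hyp V))" if "P \<in> ?B" for P :: 'a
    using that inner_le_hyp by (auto intro!: bdd_aboveI2)
  ultimately have "?B \<subseteq> dual_region UNIV hyp"
    unfolding dual_region_def by (intro interior_maximal[OF _ B] subsetI CollectI conjI)
  with assms show ?thesis by blast
qed

text \<open>Every gradient of \<open>hyp\<close> lies in the open unit ball, so \<open>UNIV\<close>
  itself is an admissible open set in the union.\<close>

lemma primal_region_hyp: "primal_region UNIV hyp = (UNIV :: 'a::euclidean_space set)"
proof -
  have "grad hyp x \<in> dual_region UNIV hyp" for x :: 'a
  proof (rule dual_region_hyp)
    have "grad hyp x \<bullet> grad hyp x = (x \<bullet> x) / (1 + x \<bullet> x)"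
      by (simp add: grad_hyp divide_inverse hyp_square flip: mult.assoc inverse_mult_distrib)
    also have "\<dots> < 1" by (simp add: add_pos_nonneg)
    finally show "grad hyp x \<bullet> grad hyp x < 1" .
  qed
  then show ?thesis
    unfolding primal_region_def using C1_on_grad_hyp open_UNIV by blast
qed

text \<open>Along a unit vector \<open>u\<close> the part of \<open>H\<close> that couples \<open>X\<close> and \<open>P\<close> is \<open>- sqrt (1 - (p + a)\<^sup>2)\<close>,
  up to a bilinear term, where \<open>grad h X = a u\<close>. The bilinear term is odd in \<open>a\<close>, so the second difference
  in \<open>a\<close> followed by the difference in \<open>p\<close> removes all terms that a separable Hamiltonian may have.\<close>

lemma H_Br_hyp_not_separable:
  fixes T :: "real set" and \<alpha> \<beta> \<gamma> :: "real \<Rightarrow> real"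
  assumes "bregman_flow (UNIV :: 'a::euclidean_space set) hyp hyp T \<alpha> \<gamma>" and t: "t \<in> T"
  shows "\<not> separable_on (H_domain T \<gamma> (UNIV :: 'a set) hyp) (H_Br \<alpha> \<beta> \<gamma> UNIV hyp hyp)"
proof
  interpret bregman_flow "UNIV :: 'a set" hyp hyp T \<alpha> \<beta> \<gamma>
    using assms(1) .
  assume "separable_on M H"
  then obtain A B :: "'a \<Rightarrow> real \<Rightarrow> real" and c d :: "real \<Rightarrow> real"
    where sep: "\<And>X P S t. (X, P, S, t) \<in> M \<Longrightarrow> H (X, P, S, t) = A P t + B X t + c t * S + d t * (P \<bullet> X)"
    unfolding separable_on_def by blast
  obtain u :: 'a where "u \<in> Basis" by (rule nonempty_Basis[THEN ex_in_conv[THEN iffD2], THEN exE])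
  then have uu: "u \<bullet> u = 1" by simp
  \<comment> \<open>\<open>P p\<close> is scaled so that the shifted momentum contributes
    \<open>p *\<^sub>R u\<close>, \<open>x a\<close> solves
    \<open>grad hyp (x a *\<^sub>R u) = a *\<^sub>R u\<close>, and \<open>N a\<close> collects the
    terms in \<open>X\<close> alone. The identity \<open>main\<close> is then taken at
    \<open>S = 0\<close>.\<close>
  define P where "P p = (exp (\<gamma> t) * p) *\<^sub>R u" for p
  define x where "x a = a / sqrt (1 - a * a)" for a :: real
  define N where "N a = hyp (x a *\<^sub>R u) + exp (\<beta> t) * hyp (x a *\<^sub>R u)" for a
  have main: "exp (\<alpha> t + \<gamma> t) * (- sqrt (1 - (p + a) * (p + a)) - (p + a) * x a + N a) =
      A (P p) t + B (x a *\<^sub>R u) t + d t * (exp (\<gamma> t) * p * x a)"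
    if "a * a < 1" "(p + a) * (p + a) < 1" for p a
  proof -
    define s where "s = sqrt (1 - a * a)"
    have s: "s > 0" "s * s = 1 - a * a" using that by (simp_all add: s_def)
    have "hyp (x a *\<^sub>R u) = 1 / s"
    proof -
      have "1 + (x a *\<^sub>R u) \<bullet> (x a *\<^sub>R u) = (1 / s) * (1 / s)"
        using s by (simp add: x_def uu s_def[symmetric] field_simps)
      then show ?thesis
      unfolding hyp_def using s by (intro real_sqrt_unique) (simp_all only: power2_eq_square, simp)
    qed
    then have g: "grad hyp (x a *\<^sub>R u) = a *\<^sub>R u"
      using s by (simp add: grad_hyp x_def s_def[symmetric])
    have Q: "exp (- \<gamma> t) *\<^sub>R P p + grad hyp (x a *\<^sub>R u) = (p + a) *\<^sub>R u"
      unfolding g P_def by (simp add: exp_minus scaleR_add_left flip: mult.assoc)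
    have QQ: "((p + a) *\<^sub>R u) \<bullet> ((p + a) *\<^sub>R u) = (p + a) * (p + a)"
      by (simp add: uu)
    have z: "(x a *\<^sub>R u, P p, 0, t) \<in> M"
      unfolding M_iff Q using t dual_region_hyp[of "(p + a) *\<^sub>R u"] that
      unfolding QQ primal_region_hyp by blast
    have "H (x a *\<^sub>R u, P p, 0, t) = exp (\<alpha> t + \<gamma> t) * (- sqrt (1 - (p + a) * (p + a)) - (p + a) * x a + N a)"
      unfolding H_eq[OF z] Q using legendre_hyp[of "(p + a) *\<^sub>R u"] that
      unfolding QQ by (simp add: N_def uu)
    then show ?thesis
      unfolding sep[OF z] by (simp add: P_def uu mult.commute[of "x a"])
  qed
  have x: "x 0 = 0" "x (- (3/10)) = - x (3/10)" by (simp_all add: x_def)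
  have N: "N (- (3/10)) = N (3/10)" unfolding N_def hyp_def x by simp
  \<comment> \<open>The samples are \<open>a\<close> in {-3/10, 0, 3/10} and \<open>p\<close> in {0,
    3/10}. The sum 6/10 gives this rational root, and the sums of absolute value 3/10 give
    \<open>sqrt (91 / 100)\<close>.\<close>
  have sq: "sqrt (16 / 25) = 4 / 5" by (rule real_sqrt_unique) (simp_all add: power2_eq_square)
  let ?E = "exp (\<alpha> t + \<gamma> t)" and ?r = "sqrt (91 / 100)" and ?y = "x (3/10)" and ?P = "P (3/10)"
  let ?k = "d t * (exp (\<gamma> t) * (3/10) * ?y)" and ?n = "N (3/10)"
  have "?E * (- (4/5) - 3/5 * ?y + ?n) = A ?P t + B (?y *\<^sub>R u) t + ?k"
    using main[of "3/10" "3/10"] by (simp add: sq)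
  moreover have "?E * (- 1 + ?n) = A ?P t + B (- ?y *\<^sub>R u) t - ?k"
    using main[of "- (3/10)" "3/10"] by (simp add: x N)
  moreover have "?E * (- ?r + N 0) = A ?P t + B 0 t"
    using main[of 0 "3/10"] by (simp add: x)
  moreover have "?E * (- ?r - 3/10 * ?y + ?n) = A (P 0) t + B (?y *\<^sub>R u) t"
    using main[of "3/10" 0] by simp
  moreover have "?E * (- ?r - 3/10 * ?y + ?n) = A (P 0) t + B (- ?y *\<^sub>R u) t"
    using main[of "- (3/10)" 0] by (simp add: x N)
  moreover have "?E * (- 1 + N 0) = A (P 0) t + B 0 t"
    using main[of 0 0] by (simp add: x)
  \<comment> \<open>Second difference in \<open>a\<close> at \<open>p = 3/10\<close> minus the one
    at \<open>p = 0\<close>: all of \<open>A\<close>, \<open>B\<close>, \<open>N\<close> and the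
    terms in \<open>?y\<close> drop out.\<close>
  ultimately have "?E * (4 * ?r - 38 / 10) = 0"
    unfolding right_diff_distrib distrib_left by linarith
  then have r: "?r = 19 / 20" by simp
  \<comment> \<open>The square of 19/20 is 361/400, whereas 91/100 is 364/400.\<close>
  have "?r * ?r = 91 / 100" by simp
  then show False unfolding r by simp
qed

text \<open>The second conjunct makes "generally non-separable" precise: whatever the given time
  functions and the dimension, some data produce a Bregman Hamiltonian that is not
  separable.\<close>

theorem theorem1:
  fixes T :: "real set" and \<alpha> \<beta> \<gamma> :: "real \<Rightarrow> real"
  assumes "open T" and "is_interval T" and "T \<noteq> {}"
    and "\<alpha> C1_differentiable_on T" and "\<beta> C1_differentiable_on T" and "\<gamma> C1_differentiable_on T"
    and ideal_scaling: "\<forall>t\<in>T. (\<gamma> has_real_derivative exp (\<alpha> t)) (at t)"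
  shows "(\<forall>(C :: 'a::euclidean_space set) h f. bregman_data C h f \<longrightarrow>
            contact_equivalent (H_domain T \<gamma> C h) (H_Br \<alpha> \<beta> \<gamma> C h f)
                               (K_domain T C h) (K_Br \<alpha> \<beta> C h f) \<and>
            separable_on (K_domain T C h) (K_Br \<alpha> \<beta> C h f)) \<and>
         (\<exists>(C :: 'a set) h f. bregman_data C h f \<and>
            \<not> separable_on (H_domain T \<gamma> C h) (H_Br \<alpha> \<beta> \<gamma> C h f))"
proof (intro conjI allI impI)
  have "continuous_on T \<alpha>"
    using assms(4) by (rule C1_differentiable_imp_continuous_on)
  then have flow: "bregman_flow C h f T \<alpha> \<gamma>" if "bregman_data C h f" for C :: "'a set" and h f
    using that assms(1) ideal_scaling by unfold_locales auto
  show "contact_equivalent (H_domain T \<gamma> C h) (H_Br \<alpha> \<beta> \<gamma> C h f)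
      (K_domain T C h) (K_Br \<alpha> \<beta> C h f)" if "bregman_data C h f" for C :: "'a set" and h f
    by (rule bregman_flow.contact_equivalence[OF flow[OF that]])
  show "separable_on (K_domain T C h) (K_Br \<alpha> \<beta> C h f)" for C :: "'a set" and h f
    by (rule separable_K_Br)
  obtain t where "t \<in> T" using assms(3) by blast
  with H_Br_hyp_not_separable[OF flow[OF bregman_data_hyp]] bregman_data_hyp
  show "\<exists>(C :: 'a set) h f. bregman_data C h f \<and>
      \<not> separable_on (H_domain T \<gamma> C h) (H_Br \<alpha> \<beta> \<gamma> C h f)"
    by blast
qed

end
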